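(* Let $R$ be a ring. For every infinite cardinal $\kappa$ and every ordinal $\alpha$, $(R\text{-}\mathrm{Mod},\leq^{(\kappa,\alpha)}_{\mathrm{pp}})$ is an AEC and $$\mathrm{LS}(R\text{-}\mathrm{Mod},\leq^{(\kappa,\alpha)}_{\mathrm{pp}})\leq 2^{(\kappa+\operatorname{card}(R)+\aleph_0)^-}.$$ Moreover, $(R\text{-}\mathrm{Mod},\leq^{(\kappa,\infty)}_{\mathrm{pp}})$ is an AEC and $\mathrm{LS}(R\text{-}\mathrm{Mod},\leq^{(\kappa,\infty)}_{\mathrm{pp}})\leq 2^{(\kappa+\operatorname{card}(R)+\aleph_0)^-}$.
   Context: Rings are associative with identity, modules are left modules, $\operatorname{card}(R)$ is the cardinality of $R$. $R\text{-}\mathrm{Mod}$ is the class of all $R$-modules, viewed as structures in the language $\tau_R=\{0,+,-\}\cup\{r\cdot\mid r\in R\}$. $A\leq B$ means submodule. For an infinite cardinal $\theta$: $\theta^-=\theta$ if $\theta$ is a limit cardinal and $\theta^-=\mu$ if $\theta=\mu^+$. AEC: a pair $\mathcal K=(\mathbf K,\preccurlyeq)$, with $\mathbf K$ a class of $L$-structures and $\preccurlyeq$ a binary relation on $\mathbf K$, such that: (i) $\mathbf K$ and $\preccurlyeq$ are closed under isomorphisms; (ii) $A\preccurlyeq B$ implies $A$ is a substructure of $B$; (iii) $\preccurlyeq$ is a partial order; (iv) if $(A_i)_{i<\delta}$ ($\delta$ limit) is an increasing continuous $\preccurlyeq$-chain in $\mathbf K$, then $A=\bigcup_{i<\delta}A_i\in\mathbf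 K$, $A_j\preccurlyeq A$ for all $j<\delta$, and if $A_i\preccurlyeq B$ for all $i<\delta$ then $A\preccurlyeq B$; (v) if $A\preccurlyeq C$, $B\preccurlyeq C$ and $A$ is a substructure of $B$ then $A\preccurlyeq B$; (vi) there is a cardinal $\lambda\geq|L|+\aleph_0$ such that for all $B\in\mathbf K$, $X\subseteq B$ there is $A\in\mathbf K$ with $X\subseteq A\preccurlyeq B$ and $|A|\leq|X|+\lambda$; the least such $\lambda$ is $\mathrm{LS}(\mathcal K)$. Infinitary pp-formulas: for an infinite cardinal $\kappa$, $\epsilon<\omega$ and an ordinal $\alpha$, the set $\Lambda^{\kappa,\aleph_0}_{\alpha,\epsilon}$ of formulas in free variables $\bar x=(x_\zeta)_{\zeta<\epsilon}$ is defined by induction on $\alpha$: $\Lambda^{\kappa,\aleph_0}_{0,\epsilon}$ is the set of equations $\sum_{\zeta<\epsilon}r_\zeta x_\zeta=0$ with $r_\zeta\in R$; for $\alpha$ limit, $\Lambda^{\kappa,\aleph_0}_{\alpha,\epsilon}=\bigcup_{\beta<\alpha}\Lambda^{\kappa,\aleph_0}_{\beta,\epsilon}$; $\Lambda^{\kappa,\aleph_0}_{\beta+1,\epsilon}$ is the set of formulas $\exists\bar y\bigwedge\Psi$ with $|\bar y|=\zeta<\omega$ ($\zeta=0$ allowed) and $\Psi\subseteq\Lambda^{\kappa,\aleph_0}_{\beta,\epsilon+\zeta}$, $|\Psi|<\kappa$. Put $\Lambda^{\kappa,\aleph_0}_\alpha=\bigcup_{\epsilon<\omega}\Lambda^{\kappa,\aleph_0}_{\alpha,\epsilon}$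 and $\Lambda^{\kappa,\aleph_0}_\infty=\bigcup_{\alpha\in\mathrm{Ord}}\Lambda^{\kappa,\aleph_0}_\alpha$. $A\leq^{(\kappa,\alpha)}_{\mathrm{pp}}B$ (respectively $A\leq^{(\kappa,\infty)}_{\mathrm{pp}}B$) iff $A\leq B$ and for every $\varphi(\bar x)\in\Lambda^{\kappa,\aleph_0}_\alpha$ (respectively $\Lambda^{\kappa,\aleph_0}_\infty$) and $\bar a\in A^{|\bar x|}$: $A\models\varphi(\bar a)\Leftrightarrow B\models\varphi(\bar a)$. *)

theory Defs
  imports "HOL-Algebra.Ring"
begin

unbundle cardinal_syntax

section \<open>First-order structures\<close>

record ('f, 'p) lang =
  fsyms :: "'f set"
  psyms :: "'p set"
  farity :: "'f \<Rightarrow> nat"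
  parity :: "'p \<Rightarrow> nat"

definition lang_card :: "('f, 'p) lang \<Rightarrow> ('f + 'p) rel"
  where "lang_card L = |fsyms L <+> psyms L|"

record ('f, 'p, 'a) struct =
  univ :: "'a set"
  fn :: "'f \<Rightarrow> 'a list \<Rightarrow> 'a"
  pr :: "'p \<Rightarrow> 'a list \<Rightarrow> bool"

definition tuples :: "'a set \<Rightarrow> nat \<Rightarrow> 'a list set"
  where "tuples A n = {xs. length xs = n \<and> set xs \<subseteq> A}"

text \<open>The interpretations are fixed to a default value outside their set-theoretic domain, so
  that equality of structures in HOL is equality of structures in the usual sense.\<close>

definition is_struct :: "('f, 'p) lang \<Rightarrow> ('f, 'p, 'a) struct \<Rightarrow> bool"
  where "is_struct L A \<longleftrightarrow>
    univ A \<noteq> {} \<and>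
    (\<forall>f\<in>fsyms L. \<forall>xs\<in>tuples (univ A) (farity L f). fn A f xs \<in> univ A) \<and>
    (\<forall>f xs. \<not> (f \<in> fsyms L \<and> xs \<in> tuples (univ A) (farity L f)) \<longrightarrow> fn A f xs = undefined) \<and>
    (\<forall>p xs. \<not> (p \<in> psyms L \<and> xs \<in> tuples (univ A) (parity L p)) \<longrightarrow> \<not> pr A p xs)"

definition substruct :: "('f, 'p) lang \<Rightarrow> ('f, 'p, 'a) struct \<Rightarrow> ('f, 'p, 'a) struct \<Rightarrow> bool"
  where "substruct L A B \<longleftrightarrow>
    is_struct L A \<and> is_struct L B \<and> univ A \<subseteq> univ B \<and>
    (\<forall>f\<in>fsyms L. \<forall>xs\<in>tuples (univ A) (farity L f). fn A f xs = fn B f xs) \<and>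
    (\<forall>p\<in>psyms L. \<forall>xs\<in>tuples (univ A) (parity L p). pr A p xs = pr B p xs)"

definition struct_iso ::
    "('f, 'p) lang \<Rightarrow> ('a \<Rightarrow> 'b) \<Rightarrow> ('f, 'p, 'a) struct \<Rightarrow> ('f, 'p, 'b) struct \<Rightarrow> bool"
  where "struct_iso L h A B \<longleftrightarrow>
    is_struct L A \<and> is_struct L B \<and> bij_betw h (univ A) (univ B) \<and>
    (\<forall>f\<in>fsyms L. \<forall>xs\<in>tuples (univ A) (farity L f). h (fn A f xs) = fn B f (map h xs)) \<and>
    (\<forall>p\<in>psyms L. \<forall>xs\<in>tuples (univ A) (parity L p). pr A p xs = pr B p (map h xs))"

text \<open>Meaningful when the structures \<open>A i\<close>, \<open>i \<in> I\<close>, form a nonempty chain under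
  \<^const>\<open>substruct\<close>.\<close>

definition union_struct ::
    "('f, 'p) lang \<Rightarrow> ('i \<Rightarrow> ('f, 'p, 'a) struct) \<Rightarrow> 'i set \<Rightarrow> ('f, 'p, 'a) struct"
  where "union_struct L A I =
    \<lparr>univ = (\<Union>i\<in>I. univ (A i)),
     fn = (\<lambda>f xs.
       if f \<in> fsyms L \<and> (\<exists>i\<in>I. xs \<in> tuples (univ (A i)) (farity L f))
       then THE y. \<exists>i\<in>I. xs \<in> tuples (univ (A i)) (farity L f) \<and> y = fn (A i) f xs
       else undefined),
     pr = (\<lambda>p xs. \<exists>i\<in>I. pr (A i) p xs)\<rparr>"


section \<open>Ordinals and cardinals\<close>

text \<open>Ordinals are represented by well-orders \<open>r\<close> with \<^term>\<open>Well_order r\<close>, cardinals by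
  relations \<open>r\<close> with \<^term>\<open>Card_order r\<close>. The ordinals below the order type of \<open>r\<close> are, up
  to isomorphism, exactly the proper initial segments of \<open>r\<close>.\<close>

definition iseg :: "'a rel \<Rightarrow> 'a \<Rightarrow> 'a rel"
  where "iseg r a = Restr r (underS r a)"

definition greatest_in :: "'a rel \<Rightarrow> 'a \<Rightarrow> bool"
  where "greatest_in r m \<longleftrightarrow> m \<in> Field r \<and> (\<forall>b\<in>Field r. (b, m) \<in> r)"

definition limit_ord :: "'a rel \<Rightarrow> bool"
  where "limit_ord r \<longleftrightarrow> Well_order r \<and> Field r \<noteq> {} \<and> (\<nexists>m. greatest_in r m)"

text \<open>For infinite \<open>\<theta>\<close> this is \<open>\<theta>\<^sup>-\<close>. If \<open>\<theta>\<close> is the successor of a cardinal at all, that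
  cardinal is already represented on the same type.\<close>

definition card_pred :: "'a rel \<Rightarrow> 'a rel"
  where "card_pred \<theta> =
    (if \<exists>\<mu> :: 'a rel. Card_order \<mu> \<and> \<theta> =o cardSuc \<mu>
     then SOME \<mu>. Card_order \<mu> \<and> \<theta> =o cardSuc \<mu>
     else \<theta>)"


section \<open>Abstract elementary classes\<close>

text \<open>A class of structures is given by its members whose universe is a subset of a type \<open>'a\<close>;
  statements about the class are polymorphic in \<open>'a\<close>.

  \<open>LS_axiom L K strong \<mu>\<close> says that \<open>\<mu>\<close> witnesses the Loewenheim-Skolem axiom.\<close>

definition LS_axiom ::
    "('f, 'p) lang \<Rightarrow> ('f, 'p, 'a) struct set \<Rightarrow>
     (('f, 'p, 'a) struct \<Rightarrow> ('f, 'p, 'a) struct \<Rightarrow> bool) \<Rightarrow> 'c rel \<Rightarrow> bool"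
  where "LS_axiom L K strong \<mu> \<longleftrightarrow>
    Card_order \<mu> \<and> lang_card L +c natLeq \<le>o \<mu> \<and>
    (\<forall>B\<in>K. \<forall>X\<subseteq>univ B. \<exists>A\<in>K. X \<subseteq> univ A \<and> strong A B \<and> |univ A| \<le>o |X| +c \<mu>)"

definition cont_chain ::
    "('f, 'p) lang \<Rightarrow> ('f, 'p, 'a) struct set \<Rightarrow>
     (('f, 'p, 'a) struct \<Rightarrow> ('f, 'p, 'a) struct \<Rightarrow> bool) \<Rightarrow>
     'i rel \<Rightarrow> ('i \<Rightarrow> ('f, 'p, 'a) struct) \<Rightarrow> bool"
  where "cont_chain L K strong \<delta> A \<longleftrightarrow>
    (\<forall>i\<in>Field \<delta>. A i \<in> K) \<and>
    (\<forall>i j. (i, j) \<in> \<delta> \<longrightarrow> strong (A i) (A j)) \<and>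
    (\<forall>j\<in>Field \<delta>. limit_ord (iseg \<delta> j) \<longrightarrow> A j = union_struct L A (underS \<delta> j))"

text \<open>HOL definitions cannot quantify over types, hence two type arguments. Chains are indexed
  by limit ordinals represented on \<open>'i\<close>, which is meant to be left arbitrary. The cardinal of the
  Loewenheim-Skolem axiom is represented on \<open>'c\<close>; this type must not depend on \<open>'a\<close>: with
  an instance of \<open>'c\<close> at least as large as \<open>'a\<close> the axiom would be trivial, whereas for a fixed
  \<open>'c\<close> and all \<open>'a\<close> it provides one cardinal for the whole class.\<close>

definition AEC ::
    "'i itself \<Rightarrow> 'c itself \<Rightarrow> ('f, 'p) lang \<Rightarrow> ('f, 'p, 'a) struct set \<Rightarrow>
     (('f, 'p, 'a) struct \<Rightarrow> ('f, 'p, 'a) struct \<Rightarrow> bool) \<Rightarrow> bool"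
  where "AEC TYPE('i) TYPE('c) L K strong \<longleftrightarrow>
    (\<forall>A\<in>K. is_struct L A) \<and>
    (\<forall>A B. strong A B \<longrightarrow> A \<in> K \<and> B \<in> K) \<and>
    (\<forall>A B h. A \<in> K \<and> struct_iso L h A B \<longrightarrow> B \<in> K) \<and>
    (\<forall>A B A' B' h. strong A B \<and> struct_iso L h B B' \<and> struct_iso L h A A' \<longrightarrow> strong A' B') \<and>
    (\<forall>A B. strong A B \<longrightarrow> substruct L A B) \<and>
    (\<forall>A\<in>K. strong A A) \<and>
    (\<forall>A B. strong A B \<and> strong B A \<longrightarrow> A = B) \<and>
    (\<forall>A B C. strong A B \<and> strong B C \<longrightarrow> strong A C) \<and>
    (\<forall>(\<delta> :: 'i rel) A. limit_ord \<delta> \<and> cont_chain L K strong \<delta> A \<longrightarrow>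
      union_struct L A (Field \<delta>) \<in> K \<and>
      (\<forall>j\<in>Field \<delta>. strong (A j) (union_struct L A (Field \<delta>))) \<and>
      (\<forall>B. (\<forall>i\<in>Field \<delta>. strong (A i) B) \<longrightarrow> strong (union_struct L A (Field \<delta>)) B)) \<and>
    (\<forall>A B C. strong A C \<and> strong B C \<and> substruct L A B \<longrightarrow> strong A B) \<and>
    (\<exists>\<mu> :: 'c rel. LS_axiom L K strong \<mu>)"

text \<open>If some \<open>\<mu> :: 'c rel\<close> satisfies the Loewenheim-Skolem axiom, then every smaller
  cardinal is represented on \<open>'c\<close>, so this is the least such cardinal, up to \<open>=o\<close>.\<close>

definition LS_number ::
    "('f, 'p) lang \<Rightarrow> ('f, 'p, 'a) struct set \<Rightarrow>
     (('f, 'p, 'a) struct \<Rightarrow> ('f, 'p, 'a) struct \<Rightarrow> bool) \<Rightarrow> 'c rel"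
  where "LS_number L K strong =
    (SOME \<mu>. LS_axiom L K strong \<mu> \<and> (\<forall>\<mu>' :: 'c rel. LS_axiom L K strong \<mu>' \<longrightarrow> \<mu> \<le>o \<mu>'))"


section \<open>Modules\<close>

datatype 'r mod_sym = Zero | Plus | Minus | Scal 'r

definition mod_lang :: "('r, 'x) ring_scheme \<Rightarrow> ('r mod_sym, unit) lang"
  where "mod_lang R =
    \<lparr>fsyms = {Zero, Plus, Minus} \<union> Scal ` carrier R,
     psyms = {},
     farity = (\<lambda>s. case s of Zero \<Rightarrow> 0 | Plus \<Rightarrow> 2 | Minus \<Rightarrow> 1 | Scal r \<Rightarrow> 1),
     parity = (\<lambda>_. 0)\<rparr>"

type_synonym ('r, 'a) mod_struct = "('r mod_sym, unit, 'a) struct"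

definition add_grp :: "('r, 'a) mod_struct \<Rightarrow> 'a monoid"
  where "add_grp M = \<lparr>carrier = univ M, mult = (\<lambda>x y. fn M Plus [x, y]), one = fn M Zero []\<rparr>"

text \<open>The locale \<open>module\<close> of HOL-Algebra is restricted to commutative rings and its records have
  components that are irrelevant for modules.\<close>

definition RMod :: "('r, 'x) ring_scheme \<Rightarrow> ('r, 'a) mod_struct set"
  where "RMod R = {M. is_struct (mod_lang R) M \<and>
    comm_group (add_grp M) \<and>
    (\<forall>x\<in>univ M. fn M Minus [x] = inv\<^bsub>add_grp M\<^esub> x) \<and>
    (\<forall>r\<in>carrier R. \<forall>x\<in>univ M. \<forall>y\<in>univ M.
      fn M (Scal r) [fn M Plus [x, y]] = fn M Plus [fn M (Scal r) [x], fn M (Scal r) [y]]) \<and>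
    (\<forall>r\<in>carrier R. \<forall>s\<in>carrier R. \<forall>x\<in>univ M.
      fn M (Scal (r \<oplus>\<^bsub>R\<^esub> s)) [x] = fn M Plus [fn M (Scal r) [x], fn M (Scal s) [x]]) \<and>
    (\<forall>r\<in>carrier R. \<forall>s\<in>carrier R. \<forall>x\<in>univ M.
      fn M (Scal (r \<otimes>\<^bsub>R\<^esub> s)) [x] = fn M (Scal r) [fn M (Scal s) [x]]) \<and>
    (\<forall>x\<in>univ M. fn M (Scal \<one>\<^bsub>R\<^esub>) [x] = x)}"


section \<open>Infinitary pp-formulas\<close>

text \<open>Free variables are addressed by position. \<open>Eqn [r\<^sub>0, \<dots>, r\<^sub>n]\<close> is the equation
  \<open>r\<^sub>0 x\<^sub>0 + \<dots> + r\<^sub>n x\<^sub>n = 0\<close>. In \<open>ExConj z \<Psi>\<close> the conjunction ranges over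
  \<^term>\<open>ran \<Psi>\<close>, and the \<open>z\<close> quantified variables are appended to the free ones. Since every set
  of fewer than \<open>\<kappa>\<close> formulas is the range of such a family indexed by a subset of the field
  of \<open>\<kappa>\<close> of size less than \<open>\<kappa>\<close>, families may be used instead of sets.\<close>

datatype ('r, 'k) ppf =
    Eqn "'r list"
  | ExConj nat "'k \<Rightarrow> ('r, 'k) ppf option"

primrec sat :: "('r, 'k) ppf \<Rightarrow> ('r, 'a) mod_struct \<Rightarrow> 'a list \<Rightarrow> bool"
  where
    "sat (Eqn rs) M xs \<longleftrightarrow>
      foldr (\<lambda>(r, x) s. fn M Plus [fn M (Scal r) [x], s]) (zip rs xs) (fn M Zero []) = fn M Zero []"
  | "sat (ExConj z \<Psi>) M xs \<longleftrightarrow>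
      (\<exists>ys\<in>tuples (univ M) z. \<forall>k.
        case (map_option sat \<circ> \<Psi>) k of None \<Rightarrow> True | Some S \<Rightarrow> S M (xs @ ys))"

lemma sat_ExConj:
  "sat (ExConj z \<Psi>) M xs \<longleftrightarrow>
    (\<exists>ys\<in>tuples (univ M) z. \<forall>\<psi>\<in>ran \<Psi>. sat \<psi> M (xs @ ys))"
proof -
  have "(\<forall>k. case (map_option sat \<circ> \<Psi>) k of None \<Rightarrow> True | Some S \<Rightarrow> S M zs) \<longleftrightarrow>
      (\<forall>\<psi>\<in>ran \<Psi>. sat \<psi> M zs)" for zs
  proof -
    have "(case (map_option sat \<circ> \<Psi>) k of None \<Rightarrow> True | Some S \<Rightarrow> S M zs) \<longleftrightarrow>
        (\<forall>\<psi>. \<Psi> k = Some \<psi> \<longrightarrow> sat \<psi> M zs)" for k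
      by (cases "\<Psi> k") auto
    then show ?thesis
      by (auto simp: ran_def)
  qed
  then show ?thesis
    by simp
qed

text \<open>\<open>\<phi> \<in> pp_level R \<kappa> \<alpha> \<epsilon>\<close> means \<open>\<phi> \<in> \<Lambda>\<^bsub>\<alpha>,\<epsilon>\<^esub>\<close> for the cardinal \<open>\<kappa>\<close>. An ordinal is
  zero, a successor or a limit according to its field being empty, having a greatest element \<open>m\<close>
  (then the ordinal is the successor of \<^term>\<open>iseg \<alpha> m\<close>), or neither.\<close>

inductive_set pp_level_rel ::
    "('r, 'x) ring_scheme \<Rightarrow> 'k rel \<Rightarrow> ('o rel \<times> nat \<times> ('r, 'k) ppf) set"
  for R \<kappa>
  where
    zero: "\<lbrakk>Field \<alpha> = {}; length rs = \<epsilon>; set rs \<subseteq> carrier R\<rbrakk>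
      \<Longrightarrow> (\<alpha>, \<epsilon>, Eqn rs) \<in> pp_level_rel R \<kappa>"
  | limit: "\<lbrakk>limit_ord \<alpha>; b \<in> Field \<alpha>; (iseg \<alpha> b, \<epsilon>, \<phi>) \<in> pp_level_rel R \<kappa>\<rbrakk>
      \<Longrightarrow> (\<alpha>, \<epsilon>, \<phi>) \<in> pp_level_rel R \<kappa>"
  | succ: "\<lbrakk>greatest_in \<alpha> m; dom \<Psi> \<subseteq> Field \<kappa>; |dom \<Psi>| <o \<kappa>;
       \<And>k \<psi>. \<Psi> k = Some \<psi> \<Longrightarrow> (iseg \<alpha> m, \<epsilon> + z, \<psi>) \<in> pp_level_rel R \<kappa>\<rbrakk>
      \<Longrightarrow> (\<alpha>, \<epsilon>, ExConj z \<Psi>) \<in> pp_level_rel R \<kappa>"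

definition pp_level ::
    "('r, 'x) ring_scheme \<Rightarrow> 'k rel \<Rightarrow> 'o rel \<Rightarrow> nat \<Rightarrow> ('r, 'k) ppf set"
  where "pp_level R \<kappa> \<alpha> \<epsilon> = {\<phi>. (\<alpha>, \<epsilon>, \<phi>) \<in> pp_level_rel R \<kappa>}"

text \<open>The union of the levels over all ordinals. Ordinals represented on \<^typ>\<open>'k set \<times> nat\<close>
  suffice; see \<open>pp_level_subset_pp_inf\<close> below.\<close>

definition pp_inf :: "('r, 'x) ring_scheme \<Rightarrow> 'k rel \<Rightarrow> nat \<Rightarrow> ('r, 'k) ppf set"
  where "pp_inf R \<kappa> \<epsilon> = (\<Union>\<alpha> \<in> {\<alpha> :: ('k set \<times> nat) rel. Well_order \<alpha>}. pp_level R \<kappa> \<alpha> \<epsilon>)"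

definition pres ::
    "('r, 'x) ring_scheme \<Rightarrow> (nat \<Rightarrow> ('r, 'k) ppf set) \<Rightarrow>
     ('r, 'a) mod_struct \<Rightarrow> ('r, 'a) mod_struct \<Rightarrow> bool"
  where "pres R \<Lambda> A B \<longleftrightarrow>
    A \<in> RMod R \<and> B \<in> RMod R \<and> substruct (mod_lang R) A B \<and>
    (\<forall>\<epsilon>. \<forall>\<phi>\<in>\<Lambda> \<epsilon>. \<forall>as\<in>tuples (univ A) \<epsilon>. sat \<phi> A as \<longleftrightarrow> sat \<phi> B as)"

definition pp_le ::
    "('r, 'x) ring_scheme \<Rightarrow> 'k rel \<Rightarrow> 'o rel \<Rightarrow>
     ('r, 'a) mod_struct \<Rightarrow> ('r, 'a) mod_struct \<Rightarrow> bool"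
  where "pp_le R \<kappa> \<alpha> = pres R (pp_level R \<kappa> \<alpha>)"

definition pp_inf_le ::
    "('r, 'x) ring_scheme \<Rightarrow> 'k rel \<Rightarrow>
     ('r, 'a) mod_struct \<Rightarrow> ('r, 'a) mod_struct \<Rightarrow> bool"
  where "pp_inf_le R \<kappa> = pres R (pp_inf R \<kappa>)"


subsection \<open>All levels are contained in the union\<close>

lemma Linear_order_iff:
  assumes "Linear_order r" "a \<in> Field r" "b \<in> Field r"
  shows "(a, b) \<in> r \<or> (b, a) \<in> r"
  using assms unfolding order_on_defs total_on_def refl_on_def by metis

definition lexnat :: "'a rel \<Rightarrow> ('a \<times> nat) rel"
  where "lexnat c = {((a, m), (b, n)). a \<in> Field c \<and> b \<in> Field c \<and>
    ((a, b) \<in> c \<and> a \<noteq> b \<or> a = b \<and> m \<le> n)}"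

lemma Field_lexnat: "Field (lexnat c) = Field c \<times> UNIV"
proof
  show "Field (lexnat c) \<subseteq> Field c \<times> UNIV"
    by (auto simp: lexnat_def Field_def)
  have "((a, n), (a, n)) \<in> lexnat c" if "a \<in> Field c" for a n
    using that by (simp add: lexnat_def)
  then show "Field c \<times> UNIV \<subseteq> Field (lexnat c)"
    by (blast intro: FieldI1)
qed

lemma Well_orderD:
  assumes "Well_order r"
  shows "\<And>a. a \<in> Field r \<Longrightarrow> (a, a) \<in> r"
    and "\<And>a b d. (a, b) \<in> r \<Longrightarrow> (b, d) \<in> r \<Longrightarrow> (a, d) \<in> r"
    and "\<And>a b. (a, b) \<in> r \<Longrightarrow> (b, a) \<in> r \<Longrightarrow> a = b"
    and "\<And>a b. a \<in> Field r \<Longrightarrow> b \<in> Field r \<Longrightarrow> (a, b) \<in> r \<or> (b, a) \<in> r"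
proof -
  have lin: "Linear_order r" using assms by (simp add: well_order_on_def)
  then show "\<And>a b. a \<in> Field r \<Longrightarrow> b \<in> Field r \<Longrightarrow> (a, b) \<in> r \<or> (b, a) \<in> r"
    by (rule Linear_order_iff)
  show "\<And>a. a \<in> Field r \<Longrightarrow> (a, a) \<in> r"
    using lin by (auto simp: order_on_defs refl_on_def)
  show "\<And>a b d. (a, b) \<in> r \<Longrightarrow> (b, d) \<in> r \<Longrightarrow> (a, d) \<in> r"
    using lin unfolding order_on_defs trans_def by blast
  show "\<And>a b. (a, b) \<in> r \<Longrightarrow> (b, a) \<in> r \<Longrightarrow> a = b"
    using lin unfolding order_on_defs antisym_def by blast
qed

lemma lexnat_Well_order:
  assumes "Well_order c"
  shows "Well_order (lexnat c)"
proof -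
  note D = Well_orderD[OF assms]
  have wfc: "wf (c - Id)"
    using assms by (auto simp: well_order_on_def)
  have "Refl (lexnat c)"
    unfolding refl_on_def Field_lexnat by (auto simp: lexnat_def)
  moreover have "trans (lexnat c)"
  proof (rule transI)
    fix x y z assume "(x, y) \<in> lexnat c" "(y, z) \<in> lexnat c"
    then show "(x, z) \<in> lexnat c"
      by (cases x; cases y; cases z) (auto simp: lexnat_def dest: D(2,3))
  qed
  moreover have "antisym (lexnat c)"
  proof (rule antisymI)
    fix x y assume "(x, y) \<in> lexnat c" "(y, x) \<in> lexnat c"
    then show "x = y"
      by (cases x; cases y) (auto simp: lexnat_def dest: D(3))
  qed
  moreover have "Total (lexnat c)"
  proof (rule total_onI)
    fix x y assume "x \<in> Field (lexnat c)" "y \<in> Field (lexnat c)" "x \<noteq> y"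
    then show "(x, y) \<in> lexnat c \<or> (y, x) \<in> lexnat c"
      using D(4)[of "fst x" "fst y"] unfolding Field_lexnat
      by (cases x; cases y) (auto simp: lexnat_def)
  qed
  moreover have "lexnat c - Id \<subseteq> (c - Id) <*lex*> less_than"
    by (auto simp: lexnat_def)
  then have "wf (lexnat c - Id)"
    using wf_lex_prod[OF wfc wf_less_than] wf_subset by blast
  ultimately show ?thesis
    by (auto simp: order_on_defs well_order_on_def intro: FieldI1 FieldI2)
qed

lemma underS_trans:
  assumes "Well_order r" "y \<in> underS r x" "z \<in> underS r y"
  shows "z \<in> underS r x"
  using assms(2,3) Well_orderD(2,3)[OF assms(1)] unfolding underS_def by blast

lemma underS_iseg:
  assumes "Well_order r" "y \<in> underS r x"
  shows "underS (iseg r x) y = underS r y"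
  using underS_trans[OF assms] assms(2) unfolding iseg_def by (auto simp: underS_def)

lemma iseg_iseg:
  assumes "Well_order r" "y \<in> underS r x"
  shows "iseg (iseg r x) y = iseg r y"
proof -
  have "underS r y \<subseteq> underS r x"
    using underS_trans[OF assms] by blast
  then show ?thesis
    using underS_iseg[OF assms] unfolding iseg_def[of "iseg r x"] by (auto simp: iseg_def)
qed

lemma Field_iseg:
  assumes "Well_order r"
  shows "Field (iseg r x) = underS r x"
proof -
  have "Refl r" using assms by (simp add: well_order_on_def order_on_defs)
  then have "(y, y) \<in> r" if "y \<in> underS r x" for y
    using that by (auto simp: underS_def refl_on_def Field_def)
  then show ?thesis by (auto simp: iseg_def Field_def)
qed

lemma Well_order_iseg: "Well_order r \<Longrightarrow> Well_order (iseg r x)"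
  unfolding iseg_def by (rule Well_order_Restr)

lemma underS_lexnat:
  assumes "(b, n) \<in> Field (lexnat c)"
  shows "underS (lexnat c) (b, n) = underS c b \<times> UNIV \<union> {b} \<times> {..<n}"
proof -
  have "b \<in> Field c" using assms by (simp add: Field_lexnat)
  then have "x \<in> underS (lexnat c) (b, n) \<longleftrightarrow> x \<in> underS c b \<times> UNIV \<union> {b} \<times> {..<n}" for x
    by (cases x) (auto simp: underS_def lexnat_def intro: FieldI1)
  then show ?thesis by blast
qed

text \<open>Consequently \<^const>\<open>pp_inf\<close> does not depend on the type chosen in its definition.\<close>

lemma pp_level_subset_pp_inf:
  fixes \<kappa> :: "'k rel" and \<alpha> :: "'o rel" and R :: "('r, 'x) ring_scheme"
  assumes inf: "Cinfinite \<kappa>"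
  shows "pp_level R \<kappa> \<alpha> \<epsilon> \<subseteq> pp_inf R \<kappa> \<epsilon>"
proof -
  define c :: "'k set rel" where "c = cardSuc |UNIV :: 'k set|"
  have infk: "infinite (UNIV :: 'k set)"
    using inf unfolding cinfinite_def by (metis infinite_super subset_UNIV)
  have ck: "Card_order |UNIV :: 'k set|" by (rule card_of_Card_order)
  have cc: "Card_order c" unfolding c_def by (rule cardSuc_Card_order[OF ck])
  have infc: "infinite (Field c)"
    unfolding c_def using cardSuc_finite[OF ck] infk by (simp add: Field_card_of)
  have wc: "Well_order c" using cc by (auto simp: card_order_on_def)
  have cinf: "Cinfinite |UNIV :: 'k set|"
    using infk ck Field_card_of by (metis cinfinite_def)
  define l where "l = lexnat c"
  have wl: "Well_order l" unfolding l_def by (rule lexnat_Well_order[OF wc])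
  have uS: "underS l (b, n) = underS c b \<times> UNIV \<union> {b} \<times> {..<n}" if "b \<in> Field c" for b n
    using that underS_lexnat[of b n c] by (simp add: l_def Field_lexnat)
  have limit0: "limit_ord (iseg l (b, 0))" if b: "b \<in> Field c" and ne: "underS c b \<noteq> {}" for b
  proof -
    have "\<not> greatest_in (iseg l (b, 0)) m" for m
    proof
      assume m: "greatest_in (iseg l (b, 0)) m"
      obtain d n where dn: "m = (d, n)" by (cases m)
      have dS: "d \<in> underS c b"
        using m uS[OF b, of 0] dn by (auto simp: greatest_in_def Field_iseg[OF wl])
      then have "(d, Suc n) \<in> Field (iseg l (b, 0))"
        using uS[OF b, of 0] by (auto simp: Field_iseg[OF wl])
      then have "((d, Suc n), (d, n)) \<in> l"
        using m dn by (auto simp: greatest_in_def iseg_def)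
      then show False by (auto simp: l_def lexnat_def)
    qed
    moreover have "Field (iseg l (b, 0)) \<noteq> {}"
      using ne uS[OF b, of 0] by (simp add: Field_iseg[OF wl])
    ultimately show ?thesis
      using Well_order_iseg[OF wl] by (auto simp: limit_ord_def)
  qed
  have up: "(iseg l (b, 0), \<epsilon>, \<phi>) \<in> pp_level_rel R \<kappa>"
    if b: "b \<in> Field c" and d: "d \<in> underS c b"
      and \<phi>: "(iseg l (d, n), \<epsilon>, \<phi>) \<in> pp_level_rel R \<kappa>" for b d n \<epsilon> \<phi>
  proof -
    have dS: "(d, n) \<in> underS l (b, 0)" using d uS[OF b, of 0] by simp
    show ?thesis
    proof (rule pp_level_rel.limit[of _ "(d, n)"])
      show "limit_ord (iseg l (b, 0))" using limit0[OF b] d by auto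
      show "(d, n) \<in> Field (iseg l (b, 0))" using dS by (simp add: Field_iseg[OF wl])
      show "(iseg (iseg l (b, 0)) (d, n), \<epsilon>, \<phi>) \<in> pp_level_rel R \<kappa>"
        using \<phi> by (simp add: iseg_iseg[OF wl dS])
    qed
  qed
  have main: "\<exists>b\<in>Field c. (iseg l (b, 0), \<epsilon>, \<phi>) \<in> pp_level_rel R \<kappa>"
    if "(\<alpha>, \<epsilon>, \<phi>) \<in> pp_level_rel R \<kappa>" for \<epsilon> \<phi> and \<alpha> :: "'o rel"
    using that
  proof (induction rule: pp_level_rel.induct)
    case (zero \<alpha> rs \<epsilon>)
    have ne: "Field c \<noteq> {}" using infc by auto
    have wo: "wo_rel c" using wc by (simp add: wo_rel_def)
    define b where "b = wo_rel.minim c (Field c)"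
    have b: "b \<in> Field c" "\<forall>d\<in>Field c. (b, d) \<in> c"
      unfolding b_def using wo_rel.minim_in[OF wo subset_refl ne] wo_rel.minim_least[OF wo subset_refl]
      by auto
    have "underS c b = {}"
      using b Well_orderD(3)[OF wc] by (auto simp: underS_def Field_def)
    then have "Field (iseg l (b, 0)) = {}" using uS[OF b(1), of 0] by (simp add: Field_iseg[OF wl])
    then show ?case by (intro bexI[of _ b] pp_level_rel.zero b(1) zero(2,3))
  next
    case (limit \<alpha> b \<epsilon> \<phi>)
    then show ?case by blast
  next
    case (succ \<alpha> m \<Psi> \<epsilon> z)
    then have "\<forall>k\<in>dom \<Psi>. \<exists>b\<in>Field c. (iseg l (b, 0), \<epsilon> + z, the (\<Psi> k)) \<in> pp_level_rel R \<kappa>"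
      by auto
    then obtain f where f: "\<And>k. k \<in> dom \<Psi> \<Longrightarrow> f k \<in> Field c \<and>
        (iseg l (f k, 0), \<epsilon> + z, the (\<Psi> k)) \<in> pp_level_rel R \<kappa>"
      by metis
    have nomax: "\<exists>b\<in>Field c. a \<in> underS c b" if "a \<in> Field c" for a
      using infinite_Card_order_limit[OF cc infc that] by (auto simp: underS_def)
    have "\<exists>i\<in>Field c. f ` dom \<Psi> \<subseteq> underS c i"
      unfolding c_def
    proof (rule cardSuc_UNION)
      show "Card_order |UNIV :: 'k set|" "infinite (Field |UNIV :: 'k set| )"
        using cinf by (auto simp: cinfinite_def)
      show "relChain (cardSuc |UNIV :: 'k set| ) (underS (cardSuc |UNIV :: 'k set| ))"
        unfolding relChain_def c_def[symmetric]
        using Well_orderD(2,3)[OF wc] unfolding underS_def by blast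
      show "f ` dom \<Psi> \<subseteq> (\<Union>i\<in>Field (cardSuc |UNIV :: 'k set| ). underS (cardSuc |UNIV :: 'k set| ) i)"
        unfolding c_def[symmetric] using f nomax by blast
      show "|f ` dom \<Psi>| \<le>o |UNIV :: 'k set|"
        by (meson card_of_image card_of_mono1 ordLeq_transitive subset_UNIV)
    qed
    then obtain b where b: "b \<in> Field c" "f ` dom \<Psi> \<subseteq> underS c b" by blast
    have conj: "(iseg l (b, 0), \<epsilon> + z, \<psi>) \<in> pp_level_rel R \<kappa>" if "\<Psi> k = Some \<psi>" for k \<psi>
    proof -
      have k: "k \<in> dom \<Psi>" using that by auto
      show ?thesis
      proof (rule up[OF b(1)])
        show "f k \<in> underS c b" using b(2) k by blast
        show "(iseg l (f k, 0), \<epsilon> + z, \<psi>) \<in> pp_level_rel R \<kappa>" using f[OF k] that by simp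
      qed
    qed
    have S: "(b, 0) \<in> underS l (b, 1)" using uS[OF b(1), of 1] by simp
    have "(iseg l (b, 1), \<epsilon>, ExConj z \<Psi>) \<in> pp_level_rel R \<kappa>"
    proof (rule pp_level_rel.succ[of _ "(b, 0)"])
      show "greatest_in (iseg l (b, 1)) (b, 0)"
        unfolding greatest_in_def Field_iseg[OF wl]
      proof (intro conjI ballI)
        fix x assume x: "x \<in> underS l (b, 1)"
        obtain d n where dn: "x = (d, n)" by (cases x)
        have "(x, (b, 0)) \<in> l"
          using x uS[OF b(1), of 1] b(1) unfolding dn
          by (auto simp: l_def lexnat_def underS_def[of c] intro: FieldI1)
        then show "(x, (b, 0)) \<in> iseg l (b, 1)"
          using x S by (simp add: iseg_def)
      qed (rule S)
      show "(iseg (iseg l (b, 1)) (b, 0), \<epsilon> + z, \<psi>) \<in> pp_level_rel R \<kappa>" if "\<Psi> k = Some \<psi>" for k \<psi>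
        using conj[OF that] by (simp only: iseg_iseg[OF wl S])
    qed (use succ in auto)
    moreover obtain d where "d \<in> Field c" "b \<in> underS c d" using nomax b(1) by blast
    ultimately show ?case using up by blast
  qed
  show ?thesis
  proof
    fix \<phi> assume "\<phi> \<in> pp_level R \<kappa> \<alpha> \<epsilon>"
    then obtain b where "(iseg l (b, 0), \<epsilon>, \<phi>) \<in> pp_level_rel R \<kappa>"
      using main unfolding pp_level_def by blast
    then show "\<phi> \<in> pp_inf R \<kappa> \<epsilon>"
      using Well_order_iseg[OF wl] unfolding pp_inf_def pp_level_def by blast
  qed
qed

end

theory Submission
  imports Defs
begin

text \<open>Write \<open>\<theta> = \<kappa> + card(R) + \<aleph>\<^sub>0\<close> and \<open>\<nu> = \<theta>\<^sup>-\<close>. Both relations of the theorem have the form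
  \<^term>\<open>pres R \<Lambda>\<close>, where \<open>\<Lambda>\<close> is a union of levels of the formula hierarchy: a single level for the
  first one, all levels for the second. So both are treated at once (\<open>AEC_pres_levels\<close>). Three of
  the axioms need an argument, the others hold by transitivity of equivalence.

  Invariance under isomorphism is an induction on formulas, once modules are known to form an
  equational class, hence to be closed under isomorphic copies, substructures and directed unions.

  For the union \<open>M\<close> of a chain, the point is that formulas quantify over finite tuples only. Every
  witness tuple in \<open>M\<close> for a formula \<open>\<exists>y \<And>\<Psi>\<close> already lies in some member \<open>A\<^sub>k\<close> of the chain. If
  truth of all formulas in \<open>\<Psi>\<close> agrees between \<open>A\<^sub>k\<close> and \<open>M\<close>, the formula holds in \<open>A\<^sub>k\<close>, and so
  it holds in every smaller member, as the chain preserves it. The induction runs over levels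
  (\<open>sat_union_pp_chain\<close>): a chain that preserves level \<open>\<beta> + 1\<close> also preserves level \<open>\<beta>\<close>, since
  \<open>\<psi>\<close> is equivalent to the formula \<open>\<exists>() \<And>{\<psi>}\<close> one level up.

  For the Loewenheim-Skolem axiom, all levels together contain at most \<open>2\<^sup>\<nu>\<close> formulas
  (\<open>card_of_ppf_over\<close>). A formula is a well-founded tree; it is determined by its set of pairs of a
  path and the label found there, a subset of a fixed set of size at most \<open>\<theta> \<le> 2\<^sup>\<nu>\<close>. Each node has
  fewer than \<open>\<kappa> \<le> \<theta>\<close> children, hence at most \<open>\<nu>\<close> of them, and therefore the whole tree has at most
  \<open>\<nu>\<close> nodes. There are no more than \<open>(2\<^sup>\<nu>)\<^sup>\<nu> = 2\<^sup>\<nu>\<close> such sets. Closing a subset of a module under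
  the module operations and under chosen witnesses for all these formulas
  (\<open>pp_Loewenheim_Skolem\<close>) gives the required submodule, by the Tarski-Vaught test.\<close>


section \<open>First-order structures\<close>

lemma tuples_iff: "xs \<in> tuples A n \<longleftrightarrow> length xs = n \<and> set xs \<subseteq> A"
  by (simp add: tuples_def)

lemma is_struct_fn:
  "is_struct L A \<Longrightarrow> \<not> (f \<in> fsyms L \<and> xs \<in> tuples (univ A) (farity L f)) \<Longrightarrow> fn A f xs = undefined"
  unfolding is_struct_def by (elim conjE) simp

lemma is_struct_pr:
  "is_struct L A \<Longrightarrow> pr A p xs \<Longrightarrow> p \<in> psyms L \<and> xs \<in> tuples (univ A) (parity L p)"
  unfolding is_struct_def by (elim conjE) (rule ccontr, simp)

lemma substruct_fn:
  "substruct L A B \<Longrightarrow> f \<in> fsyms L \<Longrightarrow> xs \<in> tuples (univ A) (farity L f) \<Longrightarrow>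
    fn A f xs = fn B f xs"
  unfolding substruct_def by blast

lemma substruct_pr:
  "substruct L A B \<Longrightarrow> p \<in> psyms L \<Longrightarrow> xs \<in> tuples (univ A) (parity L p) \<Longrightarrow>
    pr A p xs = pr B p xs"
  unfolding substruct_def by blast

lemma substruct_antisym:
  fixes A B :: "('f, 'p, 'a) struct"
  assumes AB: "substruct L A B" and BA: "substruct L B A"
  shows "A = B"
proof -
  have st: "is_struct L A" "is_struct L B" and U: "univ A = univ B"
    using AB BA by (auto simp: substruct_def)
  have "fn A f xs = fn B f xs" for f xs
  proof (cases "f \<in> fsyms L \<and> xs \<in> tuples (univ A) (farity L f)")
    case True
    then show ?thesis using substruct_fn[OF AB] by blast
  next
    case False
    then have "fn A f xs = undefined" "fn B f xs = undefined"
      using is_struct_fn[OF st(1)] is_struct_fn[OF st(2)] U by auto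
    then show ?thesis by simp
  qed
  moreover have "pr A p xs = pr B p xs" for p xs
  proof (cases "p \<in> psyms L \<and> xs \<in> tuples (univ A) (parity L p)")
    case True
    then show ?thesis using substruct_pr[OF AB] by blast
  next
    case False
    then show ?thesis using is_struct_pr[OF st(1)] is_struct_pr[OF st(2)] U by auto
  qed
  ultimately show ?thesis using U by (intro struct.equality ext) auto
qed

lemma substruct_struct_iso:
  assumes AB: "substruct L A B" and hB: "struct_iso L h B B'" and hA: "struct_iso L h A A'"
  shows "substruct L A' B'"
proof -
  have im: "univ A' = h ` univ A" "univ B' = h ` univ B"
    using hA hB by (auto simp: struct_iso_def bij_betw_def)
  have sub: "univ A \<subseteq> univ B" using AB by (simp add: substruct_def)
  have lift: "\<exists>us\<in>tuples (univ A) n. xs = map h us" if "xs \<in> tuples (univ A') n" for xs n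
  proof -
    have "xs \<in> lists (h ` univ A)" using that by (auto simp: tuples_iff im)
    then obtain us where us: "us \<in> lists (univ A)" "xs = map h us" by (auto simp: lists_image)
    then have "us \<in> tuples (univ A) n"
      using that by (simp add: tuples_iff in_lists_conv_set subset_iff)
    then show ?thesis using us(2) by blast
  qed
  have up: "us \<in> tuples (univ B) n" if "us \<in> tuples (univ A) n" for us n
    using that sub by (auto simp: tuples_iff)
  have "fn A' f xs = fn B' f xs"
    if f: "f \<in> fsyms L" and xs: "xs \<in> tuples (univ A') (farity L f)" for f xs
  proof -
    obtain us where us: "us \<in> tuples (univ A) (farity L f)" "xs = map h us"
      using lift[OF xs] by blast
    have "h (fn A f us) = fn A' f xs" using hA f us unfolding struct_iso_def by blast
    moreover have "h (fn B f us) = fn B' f xs"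
      using hB f us(2) up[OF us(1)] unfolding struct_iso_def by blast
    ultimately show ?thesis using substruct_fn[OF AB f us(1)] by simp
  qed
  moreover have "pr A' p xs = pr B' p xs"
    if p: "p \<in> psyms L" and xs: "xs \<in> tuples (univ A') (parity L p)" for p xs
  proof -
    obtain us where us: "us \<in> tuples (univ A) (parity L p)" "xs = map h us"
      using lift[OF xs] by blast
    have "pr A p us = pr A' p xs" using hA p us unfolding struct_iso_def by blast
    moreover have "pr B p us = pr B' p xs"
      using hB p us(2) up[OF us(1)] unfolding struct_iso_def by blast
    ultimately show ?thesis using substruct_pr[OF AB p us(1)] by simp
  qed
  ultimately show ?thesis
    using hA hB im sub unfolding substruct_def struct_iso_def by blast
qed

text \<open>The value of a function of the union is a definite description over all members of the chain
  that contain the arguments; it is well defined because any two members are comparable. Likewise a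
  finite list of elements lies in one member because there is a largest one among finitely many.\<close>

lemma union_struct_chain:
  assumes ne: "I \<noteq> {}"
    and str: "\<And>i. i \<in> I \<Longrightarrow> is_struct L (A i)"
    and chain: "\<And>i j. i \<in> I \<Longrightarrow> j \<in> I \<Longrightarrow> substruct L (A i) (A j) \<or> substruct L (A j) (A i)"
  shows "\<And>j. j \<in> I \<Longrightarrow> substruct L (A j) (union_struct L A I)"
    and "is_struct L (union_struct L A I)"
    and "\<And>xs. set xs \<subseteq> univ (union_struct L A I) \<Longrightarrow> \<exists>k\<in>I. set xs \<subseteq> univ (A k)"
proof -
  let ?M = "union_struct L A I"
  have U: "univ ?M = (\<Union>i\<in>I. univ (A i))" by (simp add: union_struct_def)
  show cover: "\<exists>k\<in>I. set xs \<subseteq> univ (A k)" if "set xs \<subseteq> univ ?M" for xs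
    using that
  proof (induction xs)
    case Nil
    then show ?case using ne by auto
  next
    case (Cons x xs)
    then obtain i j where ij: "i \<in> I" "x \<in> univ (A i)" "j \<in> I" "set xs \<subseteq> univ (A j)"
      by (auto simp: U)
    then show ?case using chain[of i j] by (auto simp: substruct_def)
  qed
  have fn: "fn ?M f xs = fn (A i) f xs"
    if f: "f \<in> fsyms L" and i: "i \<in> I" and xs: "xs \<in> tuples (univ (A i)) (farity L f)" for f i xs
  proof -
    have eq: "fn (A j) f xs = fn (A i) f xs"
      if j: "j \<in> I" and xs': "xs \<in> tuples (univ (A j)) (farity L f)" for j
      using chain[OF i j]
    proof
      assume "substruct L (A i) (A j)"
      from substruct_fn[OF this f xs] show ?thesis by (rule sym)
    next
      assume "substruct L (A j) (A i)"
      from substruct_fn[OF this f xs'] show ?thesis .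
    qed
    have "(THE y. \<exists>j\<in>I. xs \<in> tuples (univ (A j)) (farity L f) \<and> y = fn (A j) f xs) = fn (A i) f xs"
      by (rule the_equality) (use i xs eq in blast)+
    moreover have "f \<in> fsyms L \<and> (\<exists>i\<in>I. xs \<in> tuples (univ (A i)) (farity L f))"
      using f i xs by blast
    ultimately show ?thesis by (simp only: union_struct_def struct.simps simp_thms if_True)
  qed
  have pr: "pr ?M p xs = pr (A i) p xs"
    if p: "p \<in> psyms L" and i: "i \<in> I" and xs: "xs \<in> tuples (univ (A i)) (parity L p)" for p i xs
  proof -
    have "pr (A i) p xs" if j: "j \<in> I" and jp: "pr (A j) p xs" for j
    proof -
      have xs': "xs \<in> tuples (univ (A j)) (parity L p)"
        using is_struct_pr[OF str[OF j] jp] by blast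
      from chain[OF i j] show ?thesis
      proof
        assume "substruct L (A i) (A j)"
        from substruct_pr[OF this p xs] jp show ?thesis by simp
      next
        assume "substruct L (A j) (A i)"
        from substruct_pr[OF this p xs'] jp show ?thesis by simp
      qed
    qed
    moreover have "pr ?M p xs \<longleftrightarrow> (\<exists>i\<in>I. pr (A i) p xs)"
      by (simp add: union_struct_def)
    ultimately show ?thesis using i by blast
  qed
  have cov_tup: "\<exists>k\<in>I. xs \<in> tuples (univ (A k)) n" if "xs \<in> tuples (univ ?M) n" for xs n
    using that cover[of xs] by (auto simp: tuples_iff)
  show Mst: "is_struct L ?M"
    unfolding is_struct_def
  proof (intro conjI allI impI ballI)
    show "univ ?M \<noteq> {}" using ne str unfolding U is_struct_def by auto
  next
    fix f xs assume f: "f \<in> fsyms L" and xs: "xs \<in> tuples (univ ?M) (farity L f)"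
    then obtain k where k: "k \<in> I" "xs \<in> tuples (univ (A k)) (farity L f)"
      using cov_tup by blast
    then have "fn (A k) f xs \<in> univ (A k)"
      using str[OF k(1)] f unfolding is_struct_def by blast
    then show "fn ?M f xs \<in> univ ?M" using fn[OF f k] k(1) by (auto simp: U)
  next
    fix f xs assume "\<not> (f \<in> fsyms L \<and> xs \<in> tuples (univ ?M) (farity L f))"
    then show "fn ?M f xs = undefined" by (auto simp: union_struct_def tuples_iff)
  next
    fix p xs assume no: "\<not> (p \<in> psyms L \<and> xs \<in> tuples (univ ?M) (parity L p))"
    have "\<not> pr (A i) p xs" if i: "i \<in> I" for i
      using is_struct_pr[OF str[OF i], of p xs] no i by (auto simp: U tuples_iff)
    then show "\<not> pr ?M p xs" by (auto simp: union_struct_def)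
  qed
  show "substruct L (A j) ?M" if "j \<in> I" for j
    unfolding substruct_def using that str Mst fn pr by (auto simp: U)
qed

definition restr_struct ::
    "('f, 'p) lang \<Rightarrow> ('f, 'p, 'a) struct \<Rightarrow> 'a set \<Rightarrow> ('f, 'p, 'a) struct"
  where "restr_struct L B C =
    \<lparr>univ = C,
     fn = (\<lambda>f xs. if f \<in> fsyms L \<and> xs \<in> tuples C (farity L f) then fn B f xs else undefined),
     pr = (\<lambda>p xs. p \<in> psyms L \<and> xs \<in> tuples C (parity L p) \<and> pr B p xs)\<rparr>"

lemma substruct_restr_struct:
  assumes "is_struct L B" "C \<subseteq> univ B" "C \<noteq> {}"
    and "\<And>f xs. f \<in> fsyms L \<Longrightarrow> xs \<in> tuples C (farity L f) \<Longrightarrow> fn B f xs \<in> C"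
  shows "substruct L (restr_struct L B C) B"
  using assms unfolding substruct_def is_struct_def[of L "restr_struct L B C"]
  by (simp add: restr_struct_def) blast


section \<open>Modules as an equational class\<close>

text \<open>Embeddings of modules, covering inclusions of submodules as well as isomorphisms and their
  inverses. The language has no predicate symbols to be respected.\<close>

definition mod_emb ::
    "('r, 'x) ring_scheme \<Rightarrow> ('a \<Rightarrow> 'b) \<Rightarrow> ('r, 'a) mod_struct \<Rightarrow> ('r, 'b) mod_struct \<Rightarrow> bool"
  where "mod_emb R h A B \<longleftrightarrow>
    is_struct (mod_lang R) A \<and> is_struct (mod_lang R) B \<and>
    inj_on h (univ A) \<and> h ` univ A \<subseteq> univ B \<and>
    (\<forall>f\<in>fsyms (mod_lang R). \<forall>xs\<in>tuples (univ A) (farity (mod_lang R) f).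
      h (fn A f xs) = fn B f (map h xs))"

lemma mod_closed:
  assumes "is_struct (mod_lang R) A"
  shows "fn A Zero [] \<in> univ A"
    and "\<And>x y. x \<in> univ A \<Longrightarrow> y \<in> univ A \<Longrightarrow> fn A Plus [x, y] \<in> univ A"
    and "\<And>x. x \<in> univ A \<Longrightarrow> fn A Minus [x] \<in> univ A"
    and "\<And>r x. r \<in> carrier R \<Longrightarrow> x \<in> univ A \<Longrightarrow> fn A (Scal r) [x] \<in> univ A"
proof -
  have *: "\<And>f xs. f \<in> fsyms (mod_lang R) \<Longrightarrow> xs \<in> tuples (univ A) (farity (mod_lang R) f)
      \<Longrightarrow> fn A f xs \<in> univ A"
    using assms unfolding is_struct_def by blast
  show "fn A Zero [] \<in> univ A" by (rule *) (auto simp: mod_lang_def tuples_iff)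
  show "fn A Plus [x, y] \<in> univ A" if "x \<in> univ A" "y \<in> univ A" for x y
    by (rule *) (use that in \<open>auto simp: mod_lang_def tuples_iff\<close>)
  show "fn A Minus [x] \<in> univ A" if "x \<in> univ A" for x
    by (rule *) (use that in \<open>auto simp: mod_lang_def tuples_iff\<close>)
  show "fn A (Scal r) [x] \<in> univ A" if "r \<in> carrier R" "x \<in> univ A" for r x
    by (rule *) (use that in \<open>auto simp: mod_lang_def tuples_iff\<close>)
qed

lemma mod_emb_hom:
  assumes "mod_emb R h A B"
  shows "h (fn A Zero []) = fn B Zero []"
    and "\<And>x y. x \<in> univ A \<Longrightarrow> y \<in> univ A \<Longrightarrow> h (fn A Plus [x, y]) = fn B Plus [h x, h y]"
    and "\<And>x. x \<in> univ A \<Longrightarrow> h (fn A Minus [x]) = fn B Minus [h x]"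
    and "\<And>r x. r \<in> carrier R \<Longrightarrow> x \<in> univ A \<Longrightarrow> h (fn A (Scal r) [x]) = fn B (Scal r) [h x]"
proof -
  have *: "\<And>f xs. f \<in> fsyms (mod_lang R) \<Longrightarrow> xs \<in> tuples (univ A) (farity (mod_lang R) f)
      \<Longrightarrow> h (fn A f xs) = fn B f (map h xs)"
    using assms unfolding mod_emb_def by blast
  show "h (fn A Zero []) = fn B Zero []"
    using *[of Zero "[]"] by (auto simp: mod_lang_def tuples_iff)
  show "h (fn A Plus [x, y]) = fn B Plus [h x, h y]" if "x \<in> univ A" "y \<in> univ A" for x y
    using that *[of Plus "[x, y]"] by (auto simp: mod_lang_def tuples_iff)
  show "h (fn A Minus [x]) = fn B Minus [h x]" if "x \<in> univ A" for x
    using that *[of Minus "[x]"] by (auto simp: mod_lang_def tuples_iff)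
  show "h (fn A (Scal r) [x]) = fn B (Scal r) [h x]" if "r \<in> carrier R" "x \<in> univ A" for r x
    using that *[of "Scal r" "[x]"] by (auto simp: mod_lang_def tuples_iff)
qed

lemma substruct_mod_emb:
  assumes "substruct (mod_lang R) A B"
  shows "mod_emb R id A B"
  using assms unfolding substruct_def mod_emb_def by auto

lemma struct_iso_mod_emb:
  assumes "struct_iso (mod_lang R) h A B"
  shows "mod_emb R h A B"
  using assms unfolding struct_iso_def mod_emb_def bij_betw_def by auto

lemma struct_iso_inverse_emb:
  assumes "struct_iso (mod_lang R) h A B"
  shows "mod_emb R (inv_into (univ A) h) B A"
proof -
  let ?g = "inv_into (univ A) h"
  have A: "is_struct (mod_lang R) A" and B: "is_struct (mod_lang R) B"
    and bij: "bij_betw h (univ A) (univ B)"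
    using assms unfolding struct_iso_def by auto
  have hom: "h (fn A f xs) = fn B f (map h xs)"
    if "f \<in> fsyms (mod_lang R)" "xs \<in> tuples (univ A) (farity (mod_lang R) f)" for f xs
    using assms that unfolding struct_iso_def by blast
  have gbij: "bij_betw ?g (univ B) (univ A)"
    by (rule bij_betw_inv_into[OF bij])
  have "?g (fn B f ys) = fn A f (map ?g ys)"
    if f: "f \<in> fsyms (mod_lang R)" and ys: "ys \<in> tuples (univ B) (farity (mod_lang R) f)" for f ys
  proof -
    have mem: "map ?g ys \<in> tuples (univ A) (farity (mod_lang R) f)"
      using ys bij_betw_imp_surj_on[OF gbij] by (auto simp: tuples_iff)
    have "map h (map ?g ys) = ys"
      using ys bij_betw_inv_into_right[OF bij] by (auto simp: tuples_iff intro!: map_idI)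
    then have "h (fn A f (map ?g ys)) = fn B f ys"
      using hom[OF f mem] by simp
    moreover have "fn A f (map ?g ys) \<in> univ A"
      using A f mem unfolding is_struct_def by blast
    ultimately show ?thesis
      using bij_betw_inv_into_left[OF bij] by metis
  qed
  then show ?thesis
    using A B gbij unfolding mod_emb_def bij_betw_def by auto
qed

text \<open>The module axioms as equations in at most three variables.\<close>

definition mod_eqs :: "('r, 'x) ring_scheme \<Rightarrow> ('r, 'a) mod_struct \<Rightarrow> 'a \<Rightarrow> 'a \<Rightarrow> 'a \<Rightarrow> bool"
  where "mod_eqs R M x y z \<longleftrightarrow>
    fn M Plus [fn M Plus [x, y], z] = fn M Plus [x, fn M Plus [y, z]] \<and>
    fn M Plus [x, y] = fn M Plus [y, x] \<and>
    fn M Plus [fn M Zero [], x] = x \<and>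
    fn M Plus [fn M Minus [x], x] = fn M Zero [] \<and>
    (\<forall>r\<in>carrier R.
      fn M (Scal r) [fn M Plus [x, y]] = fn M Plus [fn M (Scal r) [x], fn M (Scal r) [y]]) \<and>
    (\<forall>r\<in>carrier R. \<forall>s\<in>carrier R.
      fn M (Scal (r \<oplus>\<^bsub>R\<^esub> s)) [x] = fn M Plus [fn M (Scal r) [x], fn M (Scal s) [x]]) \<and>
    (\<forall>r\<in>carrier R. \<forall>s\<in>carrier R.
      fn M (Scal (r \<otimes>\<^bsub>R\<^esub> s)) [x] = fn M (Scal r) [fn M (Scal s) [x]]) \<and>
    fn M (Scal \<one>\<^bsub>R\<^esub>) [x] = x"

lemma RMod_iff_eqs:
  "M \<in> RMod R \<longleftrightarrow> is_struct (mod_lang R) M \<and>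
    (\<forall>x\<in>univ M. \<forall>y\<in>univ M. \<forall>z\<in>univ M. mod_eqs R M x y z)"
proof
  assume M: "M \<in> RMod R"
  then have S: "is_struct (mod_lang R) M" and G: "comm_group (add_grp M)"
    and inv: "\<forall>x\<in>univ M. fn M Minus [x] = inv\<^bsub>add_grp M\<^esub> x"
    unfolding RMod_def by auto
  interpret G: comm_group "add_grp M" by (rule G)
  have [simp]: "carrier (add_grp M) = univ M" "\<And>x y. x \<otimes>\<^bsub>add_grp M\<^esub> y = fn M Plus [x, y]"
    "\<one>\<^bsub>add_grp M\<^esub> = fn M Zero []"
    by (simp_all add: add_grp_def)
  have "mod_eqs R M x y z" if "x \<in> univ M" "y \<in> univ M" "z \<in> univ M" for x y z
  proof -
    have "fn M Plus [fn M Plus [x, y], z] = fn M Plus [x, fn M Plus [y, z]]"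
      using that G.m_assoc[of x y z] by simp
    moreover have "fn M Plus [x, y] = fn M Plus [y, x]"
      using that G.m_comm[of x y] by simp
    moreover have "fn M Plus [fn M Zero [], x] = x" "fn M Plus [fn M Minus [x], x] = fn M Zero []"
      using that inv G.l_one[of x] G.l_inv[of x] by simp_all
    ultimately show ?thesis
      using that M unfolding mod_eqs_def RMod_def by blast
  qed
  then show "is_struct (mod_lang R) M \<and>
      (\<forall>x\<in>univ M. \<forall>y\<in>univ M. \<forall>z\<in>univ M. mod_eqs R M x y z)"
    using S by blast
next
  assume M: "is_struct (mod_lang R) M \<and>
    (\<forall>x\<in>univ M. \<forall>y\<in>univ M. \<forall>z\<in>univ M. mod_eqs R M x y z)"
  then have S: "is_struct (mod_lang R) M"
    and E: "\<And>x y z. x \<in> univ M \<Longrightarrow> y \<in> univ M \<Longrightarrow> z \<in> univ M \<Longrightarrow> mod_eqs R M x y z"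
    by auto
  have [simp]: "carrier (add_grp M) = univ M" "\<And>x y. x \<otimes>\<^bsub>add_grp M\<^esub> y = fn M Plus [x, y]"
    "\<one>\<^bsub>add_grp M\<^esub> = fn M Zero []"
    by (simp_all add: add_grp_def)
  note cl = mod_closed[OF S]
  have ax: "fn M Plus [fn M Plus [x, y], z] = fn M Plus [x, fn M Plus [y, z]]"
    "fn M Plus [x, y] = fn M Plus [y, x]" "fn M Plus [fn M Zero [], x] = x"
    "fn M Plus [fn M Minus [x], x] = fn M Zero []"
    if "x \<in> univ M" "y \<in> univ M" "z \<in> univ M" for x y z
    using E[OF that] unfolding mod_eqs_def by blast+
  have G: "comm_group (add_grp M)"
  proof (rule comm_groupI)
    show "\<exists>y\<in>carrier (add_grp M). y \<otimes>\<^bsub>add_grp M\<^esub> x = \<one>\<^bsub>add_grp M\<^esub>"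
      if "x \<in> carrier (add_grp M)" for x
      using that ax(4)[of x x x] cl(3)[of x] by auto
  next
    show "x \<otimes>\<^bsub>add_grp M\<^esub> y \<otimes>\<^bsub>add_grp M\<^esub> z = x \<otimes>\<^bsub>add_grp M\<^esub> (y \<otimes>\<^bsub>add_grp M\<^esub> z)"
      if "x \<in> carrier (add_grp M)" "y \<in> carrier (add_grp M)" "z \<in> carrier (add_grp M)" for x y z
      using that ax(1)[of x y z] by simp
  next
    show "x \<otimes>\<^bsub>add_grp M\<^esub> y = y \<otimes>\<^bsub>add_grp M\<^esub> x"
      if "x \<in> carrier (add_grp M)" "y \<in> carrier (add_grp M)" for x y
      using that ax(2)[of x y x] by simp
  next
    show "\<one>\<^bsub>add_grp M\<^esub> \<otimes>\<^bsub>add_grp M\<^esub> x = x" if "x \<in> carrier (add_grp M)" for x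
      using that ax(3)[of x x x] by simp
  qed (use cl in auto)
  interpret G: comm_group "add_grp M" by (rule G)
  have "fn M Minus [x] = inv\<^bsub>add_grp M\<^esub> x" if "x \<in> univ M" for x
    using that ax(4)[of x x x] cl(3)[of x] G.inv_equality[of "fn M Minus [x]" x] by simp
  then show "M \<in> RMod R"
    using S G E unfolding RMod_def mod_eqs_def by blast
qed

text \<open>Equations transfer along an embedding in both directions: forwards because it is a
  homomorphism, backwards because it is injective.\<close>

lemma mod_eqs_emb:
  assumes R: "ring R" and h: "mod_emb R h A B"
    and mem: "x \<in> univ A" "y \<in> univ A" "z \<in> univ A"
  shows "mod_eqs R B (h x) (h y) (h z) \<longleftrightarrow> mod_eqs R A x y z"
proof -
  interpret R: ring R by (rule R)
  have S: "is_struct (mod_lang R) A" and inj: "inj_on h (univ A)"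
    using h unfolding mod_emb_def by auto
  note cl = mod_closed[OF S]
  note hom = mod_emb_hom[OF h]
  have eq: "a = b \<longleftrightarrow> h a = h b" if "a \<in> univ A" "b \<in> univ A" for a b
    using that inj by (auto simp: inj_on_def)
  show ?thesis
    unfolding mod_eqs_def using mem by (simp add: eq cl hom cong: ball_cong)
qed

lemma RMod_emb:
  assumes "ring R" "mod_emb R h A B" "B \<in> RMod R"
  shows "A \<in> RMod R"
proof -
  have "h x \<in> univ B" if "x \<in> univ A" for x
    using that assms(2) unfolding mod_emb_def by auto
  then show ?thesis
    using assms mod_eqs_emb[OF assms(1,2)] unfolding RMod_iff_eqs mod_emb_def by blast
qed

text \<open>Each axiom mentions only three elements, so it may be checked inside a submodule that contains
  them. This is what makes unions of chains of modules into modules.\<close>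

lemma RMod_local:
  assumes R: "ring R" and M: "is_struct (mod_lang R) M"
    and loc: "\<And>xs. set xs \<subseteq> univ M \<Longrightarrow>
      \<exists>A\<in>RMod R. substruct (mod_lang R) A M \<and> set xs \<subseteq> univ A"
  shows "M \<in> RMod R"
  unfolding RMod_iff_eqs
proof (intro conjI ballI)
  fix x y z assume "x \<in> univ M" "y \<in> univ M" "z \<in> univ M"
  then obtain A where A: "A \<in> RMod R" "substruct (mod_lang R) A M" "set [x, y, z] \<subseteq> univ A"
    using loc[of "[x, y, z]"] by auto
  then show "mod_eqs R M x y z"
    using mod_eqs_emb[OF R substruct_mod_emb[OF A(2)], of x y z] unfolding RMod_iff_eqs by auto
qed (rule M)


section \<open>Satisfaction of formulas\<close>

text \<open>A common superset of all levels, with neither the level nor the number of free variables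
  recorded: one Skolem closure for these formulas serves every level at once.\<close>

inductive_set ppf_over :: "('r, 'x) ring_scheme \<Rightarrow> 'k rel \<Rightarrow> ('r, 'k) ppf set"
  for R \<kappa>
  where
    Eqn: "set rs \<subseteq> carrier R \<Longrightarrow> Eqn rs \<in> ppf_over R \<kappa>"
  | ExConj: "\<lbrakk>dom \<Psi> \<subseteq> Field \<kappa>; |dom \<Psi>| <o \<kappa>; \<And>k \<psi>. \<Psi> k = Some \<psi> \<Longrightarrow> \<psi> \<in> ppf_over R \<kappa>\<rbrakk>
      \<Longrightarrow> ExConj z \<Psi> \<in> ppf_over R \<kappa>"

lemma pp_level_rel_ppf_over: "(\<alpha>, \<epsilon>, \<phi>) \<in> pp_level_rel R \<kappa> \<Longrightarrow> \<phi> \<in> ppf_over R \<kappa>"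
  by (induction rule: pp_level_rel.induct) (auto intro: ppf_over.intros)

lemma sat_Eqn_emb:
  assumes h: "mod_emb R h A B" and rs: "set rs \<subseteq> carrier R" and xs: "set xs \<subseteq> univ A"
  shows "sat (Eqn rs) A xs \<longleftrightarrow> sat (Eqn rs) B (map h xs)"
proof -
  let ?v = "\<lambda>M xs. foldr (\<lambda>(r, x) s. fn M Plus [fn M (Scal r) [x], s]) (zip rs xs) (fn M Zero [])"
  have S: "is_struct (mod_lang R) A" and inj: "inj_on h (univ A)"
    using h unfolding mod_emb_def by auto
  note cl = mod_closed[OF S]
  note hom = mod_emb_hom[OF h]
  have "?v A xs \<in> univ A \<and> h (?v A xs) = ?v B (map h xs)"
    using rs xs
  proof (induction rs xs rule: list_induct2')
    case (4 r rs x xs)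
    then show ?case by (simp add: cl hom)
  qed (simp_all add: cl hom)
  then show ?thesis
    using inj cl(1) hom(1) by (simp add: inj_on_def) metis
qed

lemma sat_Eqn_substruct:
  assumes "substruct (mod_lang R) A B" "set rs \<subseteq> carrier R" "set xs \<subseteq> univ A"
  shows "sat (Eqn rs) A xs \<longleftrightarrow> sat (Eqn rs) B xs"
  using sat_Eqn_emb[OF substruct_mod_emb[OF assms(1)] assms(2,3)] by simp

text \<open>For a quantifier, the map must be onto, so that witnesses can be pulled back.\<close>

lemma sat_struct_iso:
  assumes iso: "struct_iso (mod_lang R) h A B"
    and \<phi>: "\<phi> \<in> ppf_over R \<kappa>" and xs: "set xs \<subseteq> univ A"
  shows "sat \<phi> A xs \<longleftrightarrow> sat \<phi> B (map h xs)"
  using \<phi> xs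
proof (induction arbitrary: xs)
  case (Eqn rs)
  then show ?case by (rule sat_Eqn_emb[OF struct_iso_mod_emb[OF iso]])
next
  case (ExConj \<Psi> z)
  have im: "h ` univ A = univ B"
    using iso by (auto simp: struct_iso_def bij_betw_def)
  have IH: "sat \<psi> A (xs @ ys) \<longleftrightarrow> sat \<psi> B (map h xs @ map h ys)"
    if "\<psi> \<in> ran \<Psi>" "ys \<in> tuples (univ A) z" for \<psi> ys
    using that ExConj.IH[of _ \<psi> "xs @ ys"] ExConj.prems by (auto simp: ran_def tuples_iff)
  have lift: "tuples (univ B) z = map h ` tuples (univ A) z"
  proof
    show "tuples (univ B) z \<subseteq> map h ` tuples (univ A) z"
    proof
      fix ys assume ys: "ys \<in> tuples (univ B) z"
      then have "ys \<in> lists (h ` univ A)" by (auto simp: tuples_iff im)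
      then obtain us where "us \<in> lists (univ A)" "ys = map h us"
        by (auto simp: lists_image)
      moreover from this have "us \<in> tuples (univ A) z"
        using ys by (simp add: tuples_iff in_lists_conv_set subset_iff)
      ultimately show "ys \<in> map h ` tuples (univ A) z" by blast
    qed
    show "map h ` tuples (univ A) z \<subseteq> tuples (univ B) z"
      unfolding im[symmetric] by (auto simp: tuples_iff intro!: imageI dest: subsetD)
  qed
  show ?case
    unfolding sat_ExConj lift by (auto simp: IH)
qed


section \<open>Unions of chains\<close>

text \<open>Preservation of level \<open>\<alpha>\<close> along the chain is part of the induction: the level decreases along
  with the formula, so the induction hypothesis is available only because preservation of a level
  implies preservation of the lower levels from which it is built.\<close>

lemma sat_union_pp_chain:
  fixes A :: "'i \<Rightarrow> ('r, 'a) mod_struct" and R :: "('r, 'x) ring_scheme" and \<kappa> :: "'k rel"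
  assumes inf: "Cinfinite \<kappa>" and \<phi>: "(\<alpha>, \<epsilon>, \<phi>) \<in> pp_level_rel R \<kappa>"
    and sub: "\<And>i. i \<in> I \<Longrightarrow> substruct (mod_lang R) (A i) M"
    and cover: "\<And>xs. set xs \<subseteq> univ M \<Longrightarrow> \<exists>k\<in>I. set xs \<subseteq> univ (A k)"
    and chain: "\<And>i j. i \<in> I \<Longrightarrow> j \<in> I \<Longrightarrow>
      pres R (pp_level R \<kappa> \<alpha>) (A i) (A j) \<or> pres R (pp_level R \<kappa> \<alpha>) (A j) (A i)"
    and j: "j \<in> I" and as: "as \<in> tuples (univ (A j)) \<epsilon>"
  shows "sat \<phi> (A j) as \<longleftrightarrow> sat \<phi> M as"
  using \<phi> chain j as
proof (induction arbitrary: j as rule: pp_level_rel.induct)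
  case (zero \<alpha> rs \<epsilon>)
  then show ?case
    using sat_Eqn_substruct[OF sub] by (auto simp: tuples_iff)
next
  case (limit \<alpha> b \<epsilon> \<phi>)
  have "pp_level R \<kappa> (iseg \<alpha> b) \<epsilon> \<subseteq> pp_level R \<kappa> \<alpha> \<epsilon>" for \<epsilon>
    using limit.hyps(1,2) by (auto simp: pp_level_def intro: pp_level_rel.limit)
  then have "pres R (pp_level R \<kappa> (iseg \<alpha> b)) N N'" if "pres R (pp_level R \<kappa> \<alpha>) N N'"
    for N N' :: "('r, 'a) mod_struct"
    using that unfolding pres_def by blast
  then show ?case using limit by meson
next
  case (succ \<alpha> m \<Psi> \<epsilon> z)
  have "Field \<kappa> \<noteq> {}" using inf by (auto simp: cinfinite_def)
  then obtain k0 where k0: "k0 \<in> Field \<kappa>" by blast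
  have single: "|{k0}| <o \<kappa>"
    by (rule Cfinite_ordLess_Cinfinite[OF _ inf])
      (simp add: cfinite_def card_of_card_order_on Field_card_of)
  \<comment> \<open>The one-element conjunction without quantifier raises a formula by one level, so the chain
    also preserves the level below.\<close>
  have lower: "pres R (pp_level R \<kappa> (iseg \<alpha> m)) N N'" if N: "pres R (pp_level R \<kappa> \<alpha>) N N'"
    for N N' :: "('r, 'a) mod_struct"
    unfolding pres_def
  proof (intro conjI allI ballI)
    fix \<epsilon> \<psi> as assume \<psi>: "\<psi> \<in> pp_level R \<kappa> (iseg \<alpha> m) \<epsilon>" and as: "as \<in> tuples (univ N) \<epsilon>"
    have "ExConj 0 [k0 \<mapsto> \<psi>] \<in> pp_level R \<kappa> \<alpha> \<epsilon>"
      using succ.hyps(1) k0 single \<psi> unfolding pp_level_def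
      by (auto intro!: pp_level_rel.succ split: if_splits)
    then have "sat (ExConj 0 [k0 \<mapsto> \<psi>]) N as \<longleftrightarrow> sat (ExConj 0 [k0 \<mapsto> \<psi>]) N' as"
      using N as unfolding pres_def by blast
    then show "sat \<psi> N as \<longleftrightarrow> sat \<psi> N' as"
      unfolding sat_ExConj by (simp add: tuples_iff)
  qed (use N in \<open>auto simp: pres_def\<close>)
  have chain': "pres R (pp_level R \<kappa> (iseg \<alpha> m)) (A i) (A j) \<or>
      pres R (pp_level R \<kappa> (iseg \<alpha> m)) (A j) (A i)" if "i \<in> I" "j \<in> I" for i j
    using succ.prems(1)[OF that] lower by blast
  have IH: "sat \<psi> (A i) (as @ ys) \<longleftrightarrow> sat \<psi> M (as @ ys)"
    if "\<psi> \<in> ran \<Psi>" "i \<in> I" "as \<in> tuples (univ (A i)) \<epsilon>" "ys \<in> tuples (univ (A i)) z" for \<psi> i ys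
    using that succ.IH[of _ \<psi> i "as @ ys"] chain' by (auto simp: ran_def tuples_iff)
  have eq: "\<exists>ys\<in>tuples (univ (A i)) z. \<forall>\<psi>\<in>ran \<Psi>. sat \<psi> M (as @ ys)"
    if "sat (ExConj z \<Psi>) (A i) as" "i \<in> I" "as \<in> tuples (univ (A i)) \<epsilon>" for i
    using that IH unfolding sat_ExConj by blast
  have subU: "tuples (univ (A i)) z \<subseteq> tuples (univ M) z" if "i \<in> I" for i
    using sub[OF that] unfolding substruct_def tuples_def by blast
  show ?case
  proof
    assume "sat (ExConj z \<Psi>) (A j) as"
    then show "sat (ExConj z \<Psi>) M as"
      using eq succ.prems(2,3) subU unfolding sat_ExConj by blast
  next
    assume "sat (ExConj z \<Psi>) M as"
    then obtain ys where ys: "ys \<in> tuples (univ M) z" "\<forall>\<psi>\<in>ran \<Psi>. sat \<psi> M (as @ ys)"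
      unfolding sat_ExConj by blast
    then obtain k where k: "k \<in> I" "ys \<in> tuples (univ (A k)) z"
      using cover[of ys] by (auto simp: tuples_iff)
    \<comment> \<open>The larger one of \<open>A j\<close> and \<open>A k\<close> contains both the parameters and the witnesses.\<close>
    have here: "sat (ExConj z \<Psi>) (A i) as"
      if "i \<in> I" "as \<in> tuples (univ (A i)) \<epsilon>" "ys \<in> tuples (univ (A i)) z" for i
      using IH[OF _ that] ys(2) that(3) unfolding sat_ExConj by blast
    have "ExConj z \<Psi> \<in> pp_level R \<kappa> \<alpha> \<epsilon>"
      unfolding pp_level_def using succ.hyps by (auto intro: pp_level_rel.succ)
    then have mono: "sat (ExConj z \<Psi>) (A j) as \<longleftrightarrow> sat (ExConj z \<Psi>) (A k) as"
      if "pres R (pp_level R \<kappa> \<alpha>) (A j) (A k)"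
      using that succ.prems(3) unfolding pres_def by blast
    have up: "tuples (univ N) n \<subseteq> tuples (univ N') n"
      if "pres R (pp_level R \<kappa> \<alpha>) N N'" for N N' :: "('r, 'a) mod_struct" and n
      using that unfolding pres_def substruct_def tuples_def by auto
    from succ.prems(1)[OF succ.prems(2) k(1)]
    show "sat (ExConj z \<Psi>) (A j) as"
    proof
      assume le: "pres R (pp_level R \<kappa> \<alpha>) (A j) (A k)"
      then show ?thesis using mono[OF le] here[OF k(1) _ k(2)] up[OF le] succ.prems(3) by blast
    next
      assume le: "pres R (pp_level R \<kappa> \<alpha>) (A k) (A j)"
      then show ?thesis using here[OF succ.prems(2,3)] up[OF le] k(2) by blast
    qed
  qed
qed


section \<open>Cardinality of the set of formulas\<close>

lemma finite_ordLeq_Cinfinite: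
  assumes "finite A" "Cinfinite r"
  shows "|A| \<le>o r"
  using assms
  by (intro ordLess_imp_ordLeq[OF Cfinite_ordLess_Cinfinite])
    (auto simp: cfinite_def card_of_card_order_on Field_card_of)

lemma nat_ordLeq_Cinfinite:
  assumes "Cinfinite r"
  shows "|UNIV :: nat set| \<le>o r"
  using natLeq_ordLeq_cinfinite[OF assms] card_of_nat ordIso_ordLeq_trans by blast

lemma lists_ordLeq_Cinfinite:
  assumes A: "|A| \<le>o r" and r: "Cinfinite r"
  shows "|lists A| \<le>o r"
proof -
  have len: "|{xs \<in> lists A. length xs = n}| \<le>o r" for n
  proof (induction n)
    case 0
    have "{xs \<in> lists A. length xs = 0} = {[]}" by auto
    then show ?case by (simp only:) (rule finite_ordLeq_Cinfinite[OF _ r], simp)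
  next
    case (Suc n)
    have eq: "{xs \<in> lists A. length xs = Suc n} =
        (\<lambda>(x, xs). x # xs) ` (A \<times> {xs \<in> lists A. length xs = n})"
      (is "?L = ?R")
    proof (rule Set.set_eqI)
      show "ys \<in> ?L \<longleftrightarrow> ys \<in> ?R" for ys by (cases ys) auto
    qed
    have "|A \<times> {xs \<in> lists A. length xs = n}| \<le>o r"
      using card_of_Times_ordLeq_infinite_Field A Suc r by (auto simp: cinfinite_def)
    then show ?case unfolding eq by (rule ordLeq_transitive[OF card_of_image])
  qed
  have "|\<Union>n. {xs \<in> lists A. length xs = n}| \<le>o r"
    using len by (intro UNION_Cinfinite_bound[OF nat_ordLeq_Cinfinite[OF r] _ r]) blast
  moreover have "(\<Union>n. {xs \<in> lists A. length xs = n}) = lists A" by blast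
  ultimately show ?thesis by (simp only:)
qed

text \<open>A nonempty set of size at most \<open>\<nu>\<close> is the image of a function on \<^term>\<open>Field \<nu>\<close>, and there
  are at most \<open>(2\<^sup>\<nu>)\<^sup>\<nu> = 2\<^sup>\<nu>\<close> functions.\<close>

lemma card_of_small_subsets:
  assumes \<nu>: "Cinfinite \<nu>" and S: "|S| \<le>o ctwo ^c \<nu>"
  shows "|{G. G \<subseteq> S \<and> |G| \<le>o \<nu>}| \<le>o ctwo ^c \<nu>"
proof -
  have pow: "Cinfinite (ctwo ^c \<nu>)"
    by (rule Cinfinite_cexp[OF ordLeq_refl[OF Card_order_ctwo] \<nu>])
  have co: "Card_order \<nu>" using \<nu> by simp
  have sub: "{G. G \<subseteq> S \<and> |G| \<le>o \<nu>} \<subseteq> {{}} \<union> (\<lambda>f. f ` Field \<nu>) ` Func (Field \<nu>) S"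
  proof
    fix G assume "G \<in> {G. G \<subseteq> S \<and> |G| \<le>o \<nu>}"
    then have G: "G \<subseteq> S" "|G| \<le>o \<nu>" by auto
    show "G \<in> {{}} \<union> (\<lambda>f. f ` Field \<nu>) ` Func (Field \<nu>) S"
    proof (cases "G = {}")
      case False
      have "|G| \<le>o |Field \<nu>|"
        using G(2) card_of_Field_ordIso[OF co] ordIso_symmetric ordLeq_ordIso_trans by blast
      then obtain g where g: "g ` Field \<nu> = G"
        using card_of_ordLeq2[OF False, of "Field \<nu>"] by auto
      define f where "f = (\<lambda>x. if x \<in> Field \<nu> then g x else undefined)"
      have "f ` Field \<nu> = G" using g by (auto simp: f_def)
      moreover have "f \<in> Func (Field \<nu>) S" using g G(1) by (auto simp: f_def Func_def)
      ultimately show ?thesis by blast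
    qed simp
  qed
  have "|Func (Field \<nu>) S| =o |S| ^c \<nu>"
    unfolding cexp_def Field_card_of by (rule card_of_refl)
  also have "|S| ^c \<nu> \<le>o (ctwo ^c \<nu>) ^c \<nu>"
    by (rule cexp_mono1[OF S co])
  also have "(ctwo ^c \<nu>) ^c \<nu> =o ctwo ^c \<nu>"
    by (rule cexp_cprod_ordLeq[OF Card_order_ctwo \<nu> Cinfinite_Cnotzero[OF \<nu>] ordLeq_refl[OF co]])
  finally have "|(\<lambda>f. f ` Field \<nu>) ` Func (Field \<nu>) S| \<le>o ctwo ^c \<nu>"
    using card_of_image ordLeq_transitive by blast
  then have "|{{}} \<union> (\<lambda>f. f ` Field \<nu>) ` Func (Field \<nu>) S| \<le>o ctwo ^c \<nu>"
    by (intro Un_Cinfinite_bound[OF finite_ordLeq_Cinfinite[OF _ pow] _ pow]) simp_all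
  then show ?thesis
    using card_of_mono1[OF sub] ordLeq_transitive by blast
qed

text \<open>If \<open>\<theta> = \<mu>\<^sup>+\<close> then \<open>\<theta> \<le> 2\<^sup>\<mu>\<close>, and sets smaller than \<open>\<theta>\<close> have size at most \<open>\<mu>\<close>; otherwise
  \<open>\<theta>\<^sup>-\<close> is \<open>\<theta>\<close> itself. These are the only properties of \<open>\<theta>\<^sup>-\<close> that the counting uses.\<close>

lemma card_pred_bounds:
  assumes \<theta>: "Cinfinite \<theta>"
  shows "Cinfinite (card_pred \<theta>)"
    and "\<theta> \<le>o ctwo ^c card_pred \<theta>"
    and "\<And>A. |A| <o \<theta> \<Longrightarrow> |A| \<le>o card_pred \<theta>"
proof -
  let ?\<nu> = "card_pred \<theta>"
  have "Cinfinite ?\<nu> \<and> \<theta> \<le>o ctwo ^c ?\<nu> \<and> (\<forall>A. |A| <o \<theta> \<longrightarrow> |A| \<le>o ?\<nu>)"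
  proof (cases "\<exists>\<mu> :: 'a rel. Card_order \<mu> \<and> \<theta> =o cardSuc \<mu>")
    case True
    then have "?\<nu> = (SOME \<mu>. Card_order \<mu> \<and> \<theta> =o cardSuc \<mu>)" by (simp add: card_pred_def)
    then have \<nu>: "Card_order ?\<nu>" "\<theta> =o cardSuc ?\<nu>" using someI_ex[OF True] by auto
    have "cinfinite ?\<nu>"
      using Cinfinite_cong[OF \<nu>(2) \<theta>] cardSuc_finite[OF \<nu>(1)] by (simp add: cinfinite_def)
    moreover have "\<theta> \<le>o ctwo ^c ?\<nu>"
      using \<nu>(2) cardSuc_least[OF \<nu>(1) Card_order_cexp ordLess_ctwo_cexp[OF \<nu>(1)]]
        ordIso_ordLeq_trans by blast
    moreover have "|A| \<le>o ?\<nu>" if "|A| <o \<theta>" for A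
      using ordLess_ordIso_trans[OF that \<nu>(2)]
        cardSuc_ordLeq_ordLess[OF \<nu>(1) card_of_Card_order] by blast
    ultimately show ?thesis using \<nu>(1) by blast
  next
    case False
    have "?\<nu> = \<theta>" unfolding card_pred_def by (rule if_not_P[OF False])
    then show ?thesis
      using \<theta> ordLess_ctwo_cexp[of \<theta>] by (auto intro: ordLess_imp_ordLeq)
  qed
  then show "Cinfinite ?\<nu>" "\<theta> \<le>o ctwo ^c ?\<nu>" "\<And>A. |A| <o \<theta> \<Longrightarrow> |A| \<le>o ?\<nu>" by auto
qed

text \<open>The graph of the labelled tree of a formula: paths from the root are lists of indices, and a node
  is labelled with its coefficients (equation) or its number of quantified variables. The recursive
  calls are written through \<open>map_option\<close> because the formulas of a conjunction are given by a
  function into an option type.\<close>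

primrec tree_code :: "('r, 'k) ppf \<Rightarrow> ('k list \<times> ('r list + nat)) set"
  where
    "tree_code (Eqn rs) = {([], Inl rs)}"
  | "tree_code (ExConj z \<Psi>) = insert ([], Inr z)
      (\<Union>k. case (map_option tree_code \<circ> \<Psi>) k of
        None \<Rightarrow> {} | Some C \<Rightarrow> (\<lambda>(p, l). (k # p, l)) ` C)"

lemma tree_code_ExConj:
  "tree_code (ExConj z \<Psi>) =
    insert ([], Inr z) (\<Union>k\<in>dom \<Psi>. (\<lambda>(p, l). (k # p, l)) ` tree_code (the (\<Psi> k)))"
proof -
  have "(case (map_option tree_code \<circ> \<Psi>) k of
      None \<Rightarrow> {} | Some C \<Rightarrow> (\<lambda>(p, l). (k # p, l)) ` C) =
    (if k \<in> dom \<Psi> then (\<lambda>(p, l). (k # p, l)) ` tree_code (the (\<Psi> k)) else {})" for k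
    by (cases "\<Psi> k") auto
  then show ?thesis by (auto split: if_splits)
qed

text \<open>The label at the root tells the outermost constructor, and the entries with first index \<open>k\<close> are
  the code of the \<open>k\<close>-th subformula. That codes are nonempty distinguishes an absent subformula from
  a present one.\<close>

lemma inj_tree_code:
  fixes \<phi> \<chi> :: "('r, 'k) ppf"
  shows "tree_code \<phi> = tree_code \<chi> \<Longrightarrow> \<phi> = \<chi>"
proof (induction \<phi> arbitrary: \<chi>)
  case (Eqn rs)
  have "([], Inl rs) \<in> tree_code \<chi>" unfolding Eqn[symmetric] by simp
  then show ?case by (cases \<chi>) (auto simp: tree_code_ExConj simp del: tree_code.simps(2))
next
  case (ExConj z \<Psi>)
  have "([], Inr z) \<in> tree_code \<chi>" unfolding ExConj.prems[symmetric] by simp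
  then obtain \<Psi>' where \<chi>: "\<chi> = ExConj z \<Psi>'"
    by (cases \<chi>) (auto simp: tree_code_ExConj simp del: tree_code.simps(2))
  have child: "{(p, l). (k # p, l) \<in> tree_code (ExConj z \<Phi>)} =
      (case \<Phi> k of None \<Rightarrow> {} | Some \<psi> \<Rightarrow> tree_code \<psi>)" for k and \<Phi> :: "'k \<Rightarrow> ('r, 'k) ppf option"
  proof -
    have "(k # p, l) \<in> tree_code (ExConj z \<Phi>) \<longleftrightarrow> (\<exists>\<psi>. \<Phi> k = Some \<psi> \<and> (p, l) \<in> tree_code \<psi>)" for p l
      unfolding tree_code_ExConj by force
    then show ?thesis by (cases "\<Phi> k") auto
  qed
  have ne: "tree_code \<psi> \<noteq> {}" for \<psi> :: "('r, 'k) ppf"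
    by (cases \<psi>) auto
  have "\<Psi> k = \<Psi>' k" for k
  proof -
    have "{(p, l). (k # p, l) \<in> tree_code (ExConj z \<Psi>)} = {(p, l). (k # p, l) \<in> tree_code (ExConj z \<Psi>')}"
      unfolding ExConj.prems[unfolded \<chi>] by (rule refl)
    then have eq: "(case \<Psi> k of None \<Rightarrow> {} | Some \<psi> \<Rightarrow> tree_code \<psi>) =
        (case \<Psi>' k of None \<Rightarrow> {} | Some \<psi> \<Rightarrow> tree_code \<psi>)"
      unfolding child .
    show ?thesis
    proof (cases "\<Psi> k")
      case None
      then show ?thesis using eq ne by (cases "\<Psi>' k") auto
    next
      case (Some \<psi>)
      then obtain \<psi>' where \<psi>': "\<Psi>' k = Some \<psi>'" using eq ne by (cases "\<Psi>' k") auto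
      then have "tree_code \<psi> = tree_code \<psi>'" using eq Some by simp
      then have "\<psi> = \<psi>'"
        using ExConj.IH[OF rangeI[of \<Psi> k], of \<psi> \<psi>'] Some by simp
      then show ?thesis using Some \<psi>' by simp
    qed
  qed
  then show ?case unfolding \<chi> by auto
qed

lemma tree_code_subset:
  "\<phi> \<in> ppf_over R \<kappa> \<Longrightarrow> tree_code \<phi> \<subseteq> lists (Field \<kappa>) \<times> (lists (carrier R) <+> UNIV)"
proof (induction rule: ppf_over.induct)
  case (Eqn rs)
  then show ?case by auto
next
  case (ExConj \<Psi> z)
  have "(\<lambda>(p, l). (k # p, l)) ` tree_code (the (\<Psi> k)) \<subseteq>
      lists (Field \<kappa>) \<times> (lists (carrier R) <+> UNIV)" if "k \<in> dom \<Psi>" for k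
    using that ExConj.hyps(1) ExConj.IH by fastforce
  then show ?case unfolding tree_code_ExConj by auto
qed

text \<open>By induction on the formula, since a union of at most \<open>\<nu>\<close> sets of size at most \<open>\<nu>\<close> has size at most \<open>\<nu>\<close>.\<close>

lemma card_of_tree_code:
  assumes \<nu>: "Cinfinite \<nu>" and small: "\<And>A :: 'k set. |A| <o \<kappa> \<Longrightarrow> |A| \<le>o \<nu>"
    and \<phi>: "\<phi> \<in> ppf_over R (\<kappa> :: 'k rel)"
  shows "|tree_code \<phi>| \<le>o \<nu>"
  using \<phi>
proof (induction rule: ppf_over.induct)
  case (Eqn rs)
  show ?case by (rule finite_ordLeq_Cinfinite[OF _ \<nu>]) simp
next
  case (ExConj \<Psi> z)
  have "|(\<lambda>(p, l). (k # p, l)) ` tree_code (the (\<Psi> k))| \<le>o \<nu>" if "k \<in> dom \<Psi>" for k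
    using that ExConj.IH[of k "the (\<Psi> k)"] card_of_image ordLeq_transitive by force
  then have "|\<Union>k\<in>dom \<Psi>. (\<lambda>(p, l). (k # p, l)) ` tree_code (the (\<Psi> k))| \<le>o \<nu>"
    using small[OF ExConj.hyps(2)] by (intro UNION_Cinfinite_bound \<nu>) auto
  then have "|{([], Inr z)} \<union> (\<Union>k\<in>dom \<Psi>. (\<lambda>(p, l). (k # p, l)) ` tree_code (the (\<Psi> k)))| \<le>o \<nu>"
    by (intro Un_Cinfinite_bound[OF finite_ordLeq_Cinfinite[OF _ \<nu>] _ \<nu>]) simp_all
  then show ?case unfolding tree_code_ExConj by simp
qed

lemma language_card_bounds:
  fixes \<kappa> :: "'k rel" and R :: "('r, 'x) ring_scheme"
  assumes \<kappa>: "Cinfinite \<kappa>"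
  shows "Cinfinite (\<kappa> +c |carrier R| +c natLeq)"
    and "\<kappa> \<le>o \<kappa> +c |carrier R| +c natLeq"
    and "|carrier R| \<le>o \<kappa> +c |carrier R| +c natLeq"
proof -
  show "Cinfinite (\<kappa> +c |carrier R| +c natLeq)" by (rule Cinfinite_csum1[OF \<kappa>])
  show "\<kappa> \<le>o \<kappa> +c |carrier R| +c natLeq" using \<kappa> by (simp add: ordLeq_csum1)
  show "|carrier R| \<le>o \<kappa> +c |carrier R| +c natLeq"
    using ordLeq_csum1[OF card_of_Card_order] ordLeq_csum2[OF Card_order_csum] ordLeq_transitive
    by blast
qed

text \<open>Bounding the number of nodes of each tree by \<open>\<theta>\<^sup>-\<close> rather than by \<open>\<theta>\<close> matters here:
  when \<open>\<theta>\<close> is a successor, a set of size \<open>\<theta>\<close> may have more than \<open>2\<close> to the power \<open>\<theta>\<^sup>-\<close>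
  subsets.\<close>

lemma card_of_ppf_over:
  fixes \<kappa> :: "'k rel" and R :: "('r, 'x) ring_scheme"
  assumes \<kappa>: "Cinfinite \<kappa>"
  shows "|ppf_over R \<kappa>| \<le>o ctwo ^c card_pred (\<kappa> +c |carrier R| +c natLeq)"
proof -
  let ?\<theta> = "\<kappa> +c |carrier R| +c natLeq" and ?S = "lists (Field \<kappa>) \<times> (lists (carrier R) <+> (UNIV :: nat set))"
  note \<theta> = language_card_bounds[OF \<kappa>, of R]
  note \<nu> = card_pred_bounds[OF \<theta>(1)]
  have inf: "\<not> finite (Field ?\<theta>)" "Card_order ?\<theta>" using \<theta>(1) by (auto simp: cinfinite_def)
  have "|Field \<kappa>| \<le>o ?\<theta>"
    using \<theta>(2) card_of_Field_ordIso \<kappa> ordIso_ordLeq_trans by blast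
  then have "|?S| \<le>o ?\<theta>"
    using \<theta> inf by (intro card_of_Times_ordLeq_infinite_Field card_of_Plus_ordLeq_infinite_Field
      lists_ordLeq_Cinfinite nat_ordLeq_Cinfinite)
  then have S: "|?S| \<le>o ctwo ^c card_pred ?\<theta>"
    using \<nu>(2) ordLeq_transitive by blast
  have "|ppf_over R \<kappa>| \<le>o |{G. G \<subseteq> ?S \<and> |G| \<le>o card_pred ?\<theta>}|"
  proof (rule card_of_ordLeqI)
    show "inj_on tree_code (ppf_over R \<kappa>)" by (rule inj_onI) (rule inj_tree_code)
    fix \<phi> assume \<phi>: "\<phi> \<in> ppf_over R \<kappa>"
    have "|tree_code \<phi>| \<le>o card_pred ?\<theta>"
      using card_of_tree_code[OF \<nu>(1) _ \<phi>] \<nu>(3) \<theta>(2) ordLess_ordLeq_trans by blast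
    then show "tree_code \<phi> \<in> {G. G \<subseteq> ?S \<and> |G| \<le>o card_pred ?\<theta>}"
      using tree_code_subset[OF \<phi>] by blast
  qed
  then show ?thesis
    using card_of_small_subsets[OF \<nu>(1) S] ordLeq_transitive by blast
qed

section \<open>Small pp-elementary submodules\<close>

text \<open>Operations take lists of arbitrary length to finite sets of values. An operation of fixed arity
  has no value on lists of another length, and a choice of witnesses returns all entries of the
  chosen tuple at once. The closure is reached after \<open>\<omega>\<close> steps since arguments are finite lists.\<close>

lemma closure_under_operations:
  fixes op :: "'i \<Rightarrow> 'a list \<Rightarrow> 'a set"
  assumes r: "Cinfinite r" and I: "|I| \<le>o r" and X: "|X| \<le>o r"
    and fin: "\<And>i xs. finite (op i xs)"
    and XU: "X \<subseteq> U" and opU: "\<And>i xs. op i xs \<subseteq> U"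
  shows "\<exists>C. X \<subseteq> C \<and> C \<subseteq> U \<and> |C| \<le>o r \<and> (\<forall>i\<in>I. \<forall>xs. set xs \<subseteq> C \<longrightarrow> op i xs \<subseteq> C)"
proof -
  define F where "F = (\<lambda>D. D \<union> (\<Union>(i, xs)\<in>I \<times> lists D. op i xs))"
  define D where "D = (\<lambda>n. (F ^^ n) X)"
  define C where "C = (\<Union>n. D n)"
  have D0: "D 0 = X" and DS: "D (Suc n) = F (D n)" for n by (simp_all add: D_def)
  have mono: "D m \<subseteq> D n" if "m \<le> n" for m n
    by (rule lift_Suc_mono_le[OF _ that]) (auto simp: DS F_def)
  have bound: "|D n| \<le>o r" for n
  proof (induction n)
    case 0
    then show ?case using X by (simp add: D0)
  next
    case (Suc n)
    have "|I \<times> lists (D n)| \<le>o r"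
      using card_of_Times_ordLeq_infinite_Field I lists_ordLeq_Cinfinite[OF Suc r] r
      by (auto simp: cinfinite_def)
    then have "|\<Union>(i, xs)\<in>I \<times> lists (D n). op i xs| \<le>o r"
      using fin by (intro UNION_Cinfinite_bound r) (auto intro: finite_ordLeq_Cinfinite[OF _ r])
    then show ?case
      unfolding DS F_def by (rule Un_Cinfinite_bound[OF Suc _ r])
  qed
  have DU: "D n \<subseteq> U" for n
  proof (induction n)
    case (Suc n)
    then show ?case using opU unfolding DS F_def by blast
  qed (simp add: D0 XU)
  have cover: "\<exists>n. set xs \<subseteq> D n" if "set xs \<subseteq> C" for xs
    using that
  proof (induction xs)
    case (Cons x xs)
    then obtain m n where "x \<in> D m" "set xs \<subseteq> D n" by (auto simp: C_def)
    then have "set (x # xs) \<subseteq> D (max m n)"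
      using mono[of m "max m n"] mono[of n "max m n"] by auto
    then show ?case by blast
  qed simp
  have "op i xs \<subseteq> C" if i: "i \<in> I" and xs: "set xs \<subseteq> C" for i xs
  proof -
    obtain n where "set xs \<subseteq> D n" using cover[OF xs] by blast
    then have "op i xs \<subseteq> D (Suc n)"
      unfolding DS F_def using i by (auto simp: in_lists_conv_set)
    then show ?thesis unfolding C_def by blast
  qed
  moreover have "X \<subseteq> C" unfolding C_def using D0 by blast
  moreover have "C \<subseteq> U" unfolding C_def using DU by blast
  moreover have "|C| \<le>o r"
    unfolding C_def using bound by (intro UNION_Cinfinite_bound nat_ordLeq_Cinfinite r) auto
  ultimately show ?thesis by blast
qed

text \<open>The Tarski-Vaught test for the fragment of pp-formulas: witnesses that work in the large module
  are to be found in the small one. There they work as well by the induction hypothesis.\<close>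

lemma tarski_vaught:
  assumes AB: "substruct (mod_lang R) A B"
    and wit: "\<And>z \<Psi> as. ExConj z \<Psi> \<in> ppf_over R \<kappa> \<Longrightarrow> set as \<subseteq> univ A \<Longrightarrow> sat (ExConj z \<Psi>) B as \<Longrightarrow>
      \<exists>ys\<in>tuples (univ A) z. \<forall>\<psi>\<in>ran \<Psi>. sat \<psi> B (as @ ys)"
    and \<phi>: "\<phi> \<in> ppf_over R \<kappa>" and as: "set as \<subseteq> univ A"
  shows "sat \<phi> A as \<longleftrightarrow> sat \<phi> B as"
  using \<phi> as
proof (induction arbitrary: as)
  case (Eqn rs)
  then show ?case by (rule sat_Eqn_substruct[OF AB])
next
  case (ExConj \<Psi> z)
  have mem: "ExConj z \<Psi> \<in> ppf_over R \<kappa>"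
    using ExConj.hyps by (intro ppf_over.ExConj)
  have IH: "sat \<psi> A (as @ ys) \<longleftrightarrow> sat \<psi> B (as @ ys)"
    if "\<psi> \<in> ran \<Psi>" "ys \<in> tuples (univ A) z" for \<psi> ys
    using that ExConj.IH[of _ \<psi> "as @ ys"] ExConj.prems by (auto simp: ran_def tuples_iff)
  have "tuples (univ A) z \<subseteq> tuples (univ B) z"
    using AB unfolding substruct_def tuples_def by blast
  then show ?case
    using wit[OF mem ExConj.prems] IH unfolding sat_ExConj by blast
qed

lemma pp_Loewenheim_Skolem:
  fixes R :: "('r, 'x) ring_scheme" and \<kappa> :: "'k rel" and B :: "('r, 'a) mod_struct"
  assumes R: "ring R" and B: "B \<in> RMod R" and XB: "X \<subseteq> univ B"
    and \<mu>: "Cinfinite \<mu>" and syms: "|fsyms (mod_lang R)| \<le>o \<mu>" and forms: "|ppf_over R \<kappa>| \<le>o \<mu>"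
  shows "\<exists>A\<in>RMod R. X \<subseteq> univ A \<and> |univ A| \<le>o |X| +c \<mu> \<and> substruct (mod_lang R) A B \<and>
    (\<forall>\<phi>\<in>ppf_over R \<kappa>. \<forall>as. set as \<subseteq> univ A \<longrightarrow> sat \<phi> A as = sat \<phi> B as)"
proof -
  let ?L = "mod_lang R" and ?r = "|X| +c \<mu>"
  \<comment> \<open>Skolem functions: the entries of a chosen witness tuple, if there is one.\<close>
  define wits where "wits = (\<lambda>(\<phi> :: ('r, 'k) ppf) as. case \<phi> of
      Eqn _ \<Rightarrow> {}
    | ExConj z \<Psi> \<Rightarrow>
        if sat \<phi> B as
        then set (SOME ys. ys \<in> tuples (univ B) z \<and> (\<forall>\<psi>\<in>ran \<Psi>. sat \<psi> B (as @ ys)))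
        else {})"
  have wits: "\<exists>ys. ys \<in> tuples (univ B) z \<and> (\<forall>\<psi>\<in>ran \<Psi>. sat \<psi> B (as @ ys)) \<and>
      wits (ExConj z \<Psi>) as = set ys" if "sat (ExConj z \<Psi>) B as" for z \<Psi> as
  proof -
    have ex: "\<exists>ys. ys \<in> tuples (univ B) z \<and> (\<forall>\<psi>\<in>ran \<Psi>. sat \<psi> B (as @ ys))"
      using that unfolding sat_ExConj by blast
    have "wits (ExConj z \<Psi>) as =
        set (SOME ys. ys \<in> tuples (univ B) z \<and> (\<forall>\<psi>\<in>ran \<Psi>. sat \<psi> B (as @ ys)))"
      using that by (simp add: wits_def del: sat.simps)
    then show ?thesis using someI_ex[OF ex] by blast
  qed
  define op where "op = (\<lambda>i xs. case i of
      Inl f \<Rightarrow> if f \<in> fsyms ?L \<and> xs \<in> tuples (univ B) (farity ?L f) then {fn B f xs} else {}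
    | Inr \<phi> \<Rightarrow> wits \<phi> xs)"
  have S: "is_struct ?L B" using B by (simp add: RMod_iff_eqs)
  have wits_fin: "finite (wits \<phi> xs) \<and> wits \<phi> xs \<subseteq> univ B" for \<phi> xs
  proof (cases \<phi>)
    case (ExConj z \<Psi>)
    show ?thesis
    proof (cases "sat \<phi> B xs")
      case True
      then show ?thesis using wits[of z \<Psi> xs] ExConj by (auto simp: tuples_iff simp del: sat.simps)
    next
      case False
      then show ?thesis unfolding ExConj by (simp add: wits_def del: sat.simps)
    qed
  qed (simp add: wits_def)
  have fin: "finite (op i xs)" for i xs
    using wits_fin by (auto simp: op_def split: sum.split)
  have opU: "op i xs \<subseteq> univ B" for i xs
    using wits_fin S unfolding is_struct_def by (auto simp: op_def split: sum.split)
  have r: "Cinfinite ?r" using \<mu> by (intro Cinfinite_csum) blast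
  have \<mu>r: "\<mu> \<le>o ?r" using \<mu> by (simp add: ordLeq_csum2)
  have "|fsyms ?L <+> ppf_over R \<kappa>| \<le>o \<mu>"
    using card_of_Plus_ordLeq_infinite_Field syms forms \<mu> by (auto simp: cinfinite_def)
  then have I: "|fsyms ?L <+> ppf_over R \<kappa>| \<le>o ?r" using \<mu>r ordLeq_transitive by blast
  have Xr: "|X| \<le>o ?r" by (rule ordLeq_csum1[OF card_of_Card_order])
  obtain C where C: "X \<subseteq> C" "C \<subseteq> univ B" "|C| \<le>o ?r"
    and cl: "\<And>i xs. i \<in> fsyms ?L <+> ppf_over R \<kappa> \<Longrightarrow> set xs \<subseteq> C \<Longrightarrow> op i xs \<subseteq> C"
    using closure_under_operations[where op = op, OF r I Xr fin XB opU] by auto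
  define A where "A = restr_struct ?L B C"
  have UA: "univ A = C" by (simp add: A_def restr_struct_def)
  have clf: "fn B f xs \<in> C" if "f \<in> fsyms ?L" "xs \<in> tuples C (farity ?L f)" for f xs
  proof -
    have "xs \<in> tuples (univ B) (farity ?L f)" using that C(2) by (auto simp: tuples_iff)
    then have "op (Inl f) xs = {fn B f xs}" using that by (simp add: op_def)
    moreover have "op (Inl f) xs \<subseteq> C" using that by (intro cl) (auto simp: tuples_iff)
    ultimately show ?thesis by simp
  qed
  have "fn B Zero [] \<in> C" by (rule clf) (auto simp: mod_lang_def tuples_iff)
  then have sub: "substruct ?L A B"
    unfolding A_def using S C(2) clf by (intro substruct_restr_struct) auto
  have A: "A \<in> RMod R" by (rule RMod_emb[OF R substruct_mod_emb[OF sub] B])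
  have "sat \<phi> A as \<longleftrightarrow> sat \<phi> B as" if \<phi>: "\<phi> \<in> ppf_over R \<kappa>" and as: "set as \<subseteq> univ A" for \<phi> as
  proof (rule tarski_vaught[OF sub _ \<phi> as])
    fix z \<Psi> as assume f: "ExConj z \<Psi> \<in> ppf_over R \<kappa>" and as: "set as \<subseteq> univ A"
      and sat: "sat (ExConj z \<Psi>) B as"
    obtain ys where ys: "ys \<in> tuples (univ B) z" "\<forall>\<psi>\<in>ran \<Psi>. sat \<psi> B (as @ ys)"
      "wits (ExConj z \<Psi>) as = set ys" using wits[OF sat] by blast
    have "op (Inr (ExConj z \<Psi>)) as \<subseteq> C" using f as by (intro cl) (auto simp: UA)
    then have "ys \<in> tuples (univ A) z" using ys(1,3) by (simp add: op_def UA tuples_iff)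
    then show "\<exists>ys\<in>tuples (univ A) z. \<forall>\<psi>\<in>ran \<Psi>. sat \<psi> B (as @ ys)" using ys(2) by blast
  qed
  then show ?thesis using A C sub UA by blast
qed


section \<open>The abstract elementary classes\<close>

lemma card_of_mod_syms:
  assumes r: "Cinfinite r" and R: "|carrier R| \<le>o r"
  shows "|fsyms (mod_lang R)| \<le>o r"
proof -
  have "|Scal ` carrier R| \<le>o r"
    using R card_of_image ordLeq_transitive by blast
  then have "|{Zero, Plus, Minus} \<union> Scal ` carrier R| \<le>o r"
    by (intro Un_Cinfinite_bound[OF finite_ordLeq_Cinfinite[OF _ r] _ r]) simp_all
  then show ?thesis by (simp add: mod_lang_def)
qed

text \<open>The same map \<open>h\<close> restricts to the isomorphism of the submodules, so truth in \<open>A'\<close> and in \<open>B'\<close>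
  can be compared through the preimages of the parameters.\<close>

lemma pres_struct_iso:
  assumes R: "ring R" and \<Lambda>: "\<And>\<epsilon>. \<Lambda> \<epsilon> \<subseteq> ppf_over R \<kappa>"
    and AB: "pres R \<Lambda> A B" and hB: "struct_iso (mod_lang R) h B B'" and hA: "struct_iso (mod_lang R) h A A'"
  shows "pres R \<Lambda> A' B'"
  unfolding pres_def
proof (intro conjI allI ballI)
  have K: "A \<in> RMod R" "B \<in> RMod R" and sub: "substruct (mod_lang R) A B"
    using AB by (auto simp: pres_def)
  show "A' \<in> RMod R" by (rule RMod_emb[OF R struct_iso_inverse_emb[OF hA] K(1)])
  show "B' \<in> RMod R" by (rule RMod_emb[OF R struct_iso_inverse_emb[OF hB] K(2)])
  show "substruct (mod_lang R) A' B'" by (rule substruct_struct_iso[OF sub hB hA])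
  fix \<epsilon> \<phi> as assume \<phi>: "\<phi> \<in> \<Lambda> \<epsilon>" and as: "as \<in> tuples (univ A') \<epsilon>"
  have "as \<in> lists (h ` univ A)"
    using as hA by (auto simp: tuples_iff struct_iso_def bij_betw_def)
  then obtain us where us: "us \<in> lists (univ A)" "as = map h us" by (auto simp: lists_image)
  have usA: "set us \<subseteq> univ A" "us \<in> tuples (univ A) \<epsilon>"
    using us as by (auto simp: tuples_iff)
  have "sat \<phi> A us \<longleftrightarrow> sat \<phi> B us" using AB \<phi> usA(2) unfolding pres_def by blast
  moreover have "set us \<subseteq> univ B" using usA(1) sub by (auto simp: substruct_def)
  ultimately show "sat \<phi> A' as \<longleftrightarrow> sat \<phi> B' as"
    using sat_struct_iso[OF hA _ usA(1), of \<phi> \<kappa>] sat_struct_iso[OF hB, of \<phi> \<kappa> us] \<Lambda> \<phi> us(2)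
    by blast
qed

text \<open>That the union is below every upper bound \<open>B\<close> of the chain needs no further induction: parameters
  from the union lie in some \<open>A k\<close>, whose formulas have the same truth value in the union and in
  \<open>B\<close>.\<close>

lemma pres_union_chain:
  fixes R :: "('r, 'x) ring_scheme" and \<kappa> :: "'k rel" and S :: "'o rel set"
    and A :: "'i \<Rightarrow> ('r, 'a) mod_struct"
  defines "\<Lambda> \<equiv> \<lambda>\<epsilon>. \<Union>\<alpha>\<in>S. pp_level R \<kappa> \<alpha> \<epsilon>"
  assumes R: "ring R" and \<kappa>: "Cinfinite \<kappa>" and ne: "I \<noteq> {}"
    and K: "\<And>i. i \<in> I \<Longrightarrow> A i \<in> RMod R"
    and chain: "\<And>i j. i \<in> I \<Longrightarrow> j \<in> I \<Longrightarrow> pres R \<Lambda> (A i) (A j) \<or> pres R \<Lambda> (A j) (A i)"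
  shows "union_struct (mod_lang R) A I \<in> RMod R"
    and "\<And>j. j \<in> I \<Longrightarrow> pres R \<Lambda> (A j) (union_struct (mod_lang R) A I)"
    and "\<And>B. (\<And>i. i \<in> I \<Longrightarrow> pres R \<Lambda> (A i) B) \<Longrightarrow> pres R \<Lambda> (union_struct (mod_lang R) A I) B"
proof -
  let ?L = "mod_lang R"
  let ?M = "union_struct ?L A I"
  have "substruct ?L (A i) (A j) \<or> substruct ?L (A j) (A i)" if "i \<in> I" "j \<in> I" for i j
    using chain[OF that] unfolding pres_def by blast
  moreover have "is_struct ?L (A i)" if "i \<in> I" for i
    using K[OF that] by (simp add: RMod_iff_eqs)
  ultimately have sub: "\<And>j. j \<in> I \<Longrightarrow> substruct ?L (A j) ?M" and st: "is_struct ?L ?M"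
    and cover: "\<And>xs. set xs \<subseteq> univ ?M \<Longrightarrow> \<exists>k\<in>I. set xs \<subseteq> univ (A k)"
    using union_struct_chain[OF ne, of ?L A] by blast+
  show M: "?M \<in> RMod R"
    by (rule RMod_local[OF R st]) (use cover sub K in blast)
  show up: "pres R \<Lambda> (A j) ?M" if j: "j \<in> I" for j
    unfolding pres_def
  proof (intro conjI allI ballI)
    fix \<epsilon> \<phi> as assume \<phi>: "\<phi> \<in> \<Lambda> \<epsilon>" and as: "as \<in> tuples (univ (A j)) \<epsilon>"
    then obtain \<alpha> where \<alpha>: "\<alpha> \<in> S" "(\<alpha>, \<epsilon>, \<phi>) \<in> pp_level_rel R \<kappa>"
      by (auto simp: \<Lambda>_def pp_level_def)
    have "pres R (pp_level R \<kappa> \<alpha>) N N'" if "pres R \<Lambda> N N'" for N N' :: "('r, 'a) mod_struct"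
      using that \<alpha>(1) unfolding pres_def \<Lambda>_def by blast
    then show "sat \<phi> (A j) as \<longleftrightarrow> sat \<phi> ?M as"
      using chain by (intro sat_union_pp_chain[OF \<kappa> \<alpha>(2) sub cover _ j as]) blast+
  qed (use K M sub j in auto)
  show "pres R \<Lambda> ?M B" if B: "\<And>i. i \<in> I \<Longrightarrow> pres R \<Lambda> (A i) B" for B
    unfolding pres_def
  proof (intro conjI allI ballI)
    have subB: "substruct ?L (A i) B" if "i \<in> I" for i using B[OF that] by (simp add: pres_def)
    show "?M \<in> RMod R" by (rule M)
    show KB: "B \<in> RMod R" using B ne by (auto simp: pres_def)
    have tup: "\<exists>k\<in>I. xs \<in> tuples (univ (A k)) n" if "xs \<in> tuples (univ ?M) n" for xs n
      using that cover[of xs] by (auto simp: tuples_iff)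
    show "substruct ?L ?M B"
      unfolding substruct_def
    proof (intro conjI ballI)
      show "is_struct ?L ?M" by (rule st)
      show "is_struct ?L B" using KB by (simp add: RMod_iff_eqs)
      show "univ ?M \<subseteq> univ B" 
        using subB unfolding substruct_def by (simp add: union_struct_def UN_subset_iff)
      show "fn ?M f xs = fn B f xs"
        if f: "f \<in> fsyms ?L" and xs: "xs \<in> tuples (univ ?M) (farity ?L f)" for f xs
      proof -
        obtain k where k: "k \<in> I" "xs \<in> tuples (univ (A k)) (farity ?L f)" using tup[OF xs] by blast
        show ?thesis using substruct_fn[OF sub[OF k(1)] f k(2)] substruct_fn[OF subB[OF k(1)] f k(2)]
          by simp
      qed
      show "pr ?M p xs = pr B p xs" if "p \<in> psyms ?L" for p xs
        using that by (simp add: mod_lang_def)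
    qed
    fix \<epsilon> \<phi> as assume \<phi>: "\<phi> \<in> \<Lambda> \<epsilon>" and as: "as \<in> tuples (univ ?M) \<epsilon>"
    then obtain k where k: "k \<in> I" "as \<in> tuples (univ (A k)) \<epsilon>" using tup by blast
    have "sat \<phi> (A k) as \<longleftrightarrow> sat \<phi> ?M as" using up[OF k(1)] \<phi> k(2) unfolding pres_def by blast
    moreover have "sat \<phi> (A k) as \<longleftrightarrow> sat \<phi> B as" using B[OF k(1)] \<phi> k(2) unfolding pres_def by blast
    ultimately show "sat \<phi> ?M as \<longleftrightarrow> sat \<phi> B as" by simp
  qed
qed

text \<open>The bound \<open>2\<^sup>\<nu>\<close> does not depend on the levels in \<open>\<Lambda>\<close>: the submodule found preserves all formulas
  over \<open>R\<close> and \<open>\<kappa>\<close>, hence those in \<open>\<Lambda>\<close>.\<close>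

lemma LS_axiom_pres:
  fixes R :: "('r, 'x) ring_scheme" and \<kappa> :: "'k rel"
  assumes R: "ring R" and \<kappa>: "Cinfinite \<kappa>" and \<Lambda>: "\<And>\<epsilon>. \<Lambda> \<epsilon> \<subseteq> ppf_over R \<kappa>"
  shows "LS_axiom (mod_lang R) (RMod R :: ('r, 'a) mod_struct set) (pres R \<Lambda>)
    (ctwo ^c card_pred (\<kappa> +c |carrier R| +c natLeq))"
proof -
  let ?\<theta> = "\<kappa> +c |carrier R| +c natLeq"
  let ?\<mu> = "ctwo ^c card_pred ?\<theta>"
  note \<theta> = language_card_bounds[OF \<kappa>, of R]
  note \<nu> = card_pred_bounds[OF \<theta>(1)]
  have \<mu>: "Cinfinite ?\<mu>" by (rule Cinfinite_cexp[OF ordLeq_refl[OF Card_order_ctwo] \<nu>(1)])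
  have syms: "|fsyms (mod_lang R)| \<le>o ?\<mu>"
    using card_of_mod_syms[OF \<theta>(1,3)] \<nu>(2) ordLeq_transitive by blast
  have "|fsyms (mod_lang R) <+> psyms (mod_lang R)| \<le>o ?\<mu>"
    using syms \<mu> finite_ordLeq_Cinfinite[OF _ \<mu>, of "psyms (mod_lang R)"]
    by (intro card_of_Plus_ordLeq_infinite_Field) (auto simp: cinfinite_def)
  then have lang: "lang_card (mod_lang R) +c natLeq \<le>o ?\<mu>"
    unfolding lang_card_def
    using natLeq_ordLeq_cinfinite[OF \<mu>] \<mu>
    by (intro csum_cinfinite_bound card_of_Card_order natLeq_Card_order)
  show ?thesis
    unfolding LS_axiom_def
  proof (intro conjI ballI allI impI)
    show "Card_order ?\<mu>" by (rule Card_order_cexp)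
    show "lang_card (mod_lang R) +c natLeq \<le>o ?\<mu>" by (rule lang)
    fix B :: "('r, 'a) mod_struct" and X assume B: "B \<in> RMod R" and X: "X \<subseteq> univ B"
    obtain A where A: "A \<in> RMod R" "X \<subseteq> univ A" "|univ A| \<le>o |X| +c ?\<mu>" "substruct (mod_lang R) A B"
      and sat: "\<And>\<phi> as. \<phi> \<in> ppf_over R \<kappa> \<Longrightarrow> set as \<subseteq> univ A \<Longrightarrow> sat \<phi> A as = sat \<phi> B as"
      using pp_Loewenheim_Skolem[OF R B X \<mu> syms card_of_ppf_over[OF \<kappa>]] by blast
    have "pres R \<Lambda> A B"
      unfolding pres_def
    proof (intro conjI allI ballI)
      fix \<epsilon> \<phi> as assume "\<phi> \<in> \<Lambda> \<epsilon>" "as \<in> tuples (univ A) \<epsilon>"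
      then show "sat \<phi> A as = sat \<phi> B as" using \<Lambda> by (intro sat) (auto simp: tuples_iff)
    qed (use A B in auto)
    then show "\<exists>A\<in>RMod R. X \<subseteq> univ A \<and> pres R \<Lambda> A B \<and> |univ A| \<le>o |X| +c ?\<mu>"
      using A by blast
  qed
qed

text \<open>The least cardinal exists by well-foundedness of \<open>\<le>o\<close>, so the choice in the definition is made
  from a nonempty set.\<close>

lemma LS_number_ordLeq:
  fixes \<mu> :: "'c rel"
  assumes "LS_axiom L K strong \<mu>"
  shows "(LS_number L K strong :: 'c rel) \<le>o \<mu>"
proof -
  let ?P = "{\<mu> :: 'c rel. LS_axiom L K strong \<mu>}"
  have ne: "?P \<noteq> {}" using assms by blast
  have co: "\<forall>\<mu>\<in>?P. Card_order \<mu>" by (simp add: LS_axiom_def)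
  have "\<exists>\<mu> :: 'c rel. LS_axiom L K strong \<mu> \<and> (\<forall>\<mu>' :: 'c rel. LS_axiom L K strong \<mu>' \<longrightarrow> \<mu> \<le>o \<mu>')"
    using exists_minim_Card_order[OF ne co] by auto
  from someI_ex[OF this] show ?thesis
    unfolding LS_number_def using assms by blast
qed

lemma AEC_pres_levels:
  fixes R :: "('r, 'x) ring_scheme" and \<kappa> :: "'k rel" and S :: "'o rel set"
  defines "\<Lambda> \<equiv> \<lambda>\<epsilon>. \<Union>\<alpha>\<in>S. pp_level R \<kappa> \<alpha> \<epsilon>"
  assumes R: "ring R" and \<kappa>: "Cinfinite \<kappa>"
  shows "AEC TYPE('i) TYPE('k + 'r + nat \<Rightarrow> bool) (mod_lang R)
      (RMod R :: ('r, 'a) mod_struct set) (pres R \<Lambda>)"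
    and "(LS_number (mod_lang R) (RMod R :: ('r, 'a) mod_struct set) (pres R \<Lambda>)
        :: ('k + 'r + nat \<Rightarrow> bool) rel)
      \<le>o ctwo ^c card_pred (\<kappa> +c |carrier R| +c natLeq)"
proof -
  let ?L = "mod_lang R" and ?K = "RMod R :: ('r, 'a) mod_struct set"
  have over: "\<Lambda> \<epsilon> \<subseteq> ppf_over R \<kappa>" for \<epsilon>
    unfolding \<Lambda>_def pp_level_def using pp_level_rel_ppf_over by blast
  note LS = LS_axiom_pres[where \<Lambda> = \<Lambda>, OF R \<kappa> over]
  show "(LS_number ?L ?K (pres R \<Lambda>) :: ('k + 'r + nat \<Rightarrow> bool) rel)
      \<le>o ctwo ^c card_pred (\<kappa> +c |carrier R| +c natLeq)"
    by (rule LS_number_ordLeq[OF LS])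
  show "AEC TYPE('i) TYPE('k + 'r + nat \<Rightarrow> bool) ?L ?K (pres R \<Lambda>)"
    unfolding AEC_def
  proof (intro conjI)
    show "\<forall>A\<in>?K. is_struct ?L A" by (simp add: RMod_iff_eqs)
    show "\<forall>A B. pres R \<Lambda> A B \<longrightarrow> A \<in> ?K \<and> B \<in> ?K" by (simp add: pres_def)
    show "\<forall>A B h. A \<in> ?K \<and> struct_iso ?L h A B \<longrightarrow> B \<in> ?K"
      using RMod_emb[OF R struct_iso_inverse_emb] by blast
    show "\<forall>A B A' B' h. pres R \<Lambda> A B \<and> struct_iso ?L h B B' \<and> struct_iso ?L h A A' \<longrightarrow>
        pres R \<Lambda> A' (B' :: ('r, 'a) mod_struct)"
      using pres_struct_iso[where \<Lambda> = \<Lambda>, OF R over] by blast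
    show "\<forall>A B. pres R \<Lambda> A B \<longrightarrow> substruct ?L A B" by (simp add: pres_def)
    show "\<forall>A\<in>?K. pres R \<Lambda> A A" by (simp add: pres_def substruct_def RMod_iff_eqs)
    show "\<forall>A B. pres R \<Lambda> A B \<and> pres R \<Lambda> B A \<longrightarrow> A = B"
      unfolding pres_def using substruct_antisym by blast
    have trans: "pres R \<Lambda> A C" if AB: "pres R \<Lambda> A B" and BC: "pres R \<Lambda> B C"
      for A B C :: "('r, 'a) mod_struct"
      unfolding pres_def
    proof (intro conjI allI ballI)
      have sub: "substruct ?L A B" "substruct ?L B C" using AB BC by (simp_all add: pres_def)
      then have up: "tuples (univ A) n \<subseteq> tuples (univ B) n" for n
        unfolding substruct_def tuples_def by blast
      show "A \<in> RMod R" "C \<in> RMod R" using AB BC by (simp_all add: pres_def)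
      show "substruct ?L A C"
        using sub up unfolding substruct_def by (simp add: subset_iff)
      fix \<epsilon> \<phi> as assume "\<phi> \<in> \<Lambda> \<epsilon>" "as \<in> tuples (univ A) \<epsilon>"
      then show "sat \<phi> A as \<longleftrightarrow> sat \<phi> C as" using AB BC up[of \<epsilon>] unfolding pres_def by blast
    qed
    then show "\<forall>A B C. pres R \<Lambda> A B \<and> pres R \<Lambda> B C \<longrightarrow> pres R \<Lambda> A (C :: ('r, 'a) mod_struct)"
      by blast
    show "\<forall>A B C. pres R \<Lambda> A C \<and> pres R \<Lambda> B C \<and> substruct ?L A B \<longrightarrow>
        pres R \<Lambda> A (B :: ('r, 'a) mod_struct)"
    proof (intro allI impI, elim conjE)
      fix A B C :: "('r, 'a) mod_struct"
      assume AC: "pres R \<Lambda> A C" and BC: "pres R \<Lambda> B C" and AB: "substruct ?L A B"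
      then have "tuples (univ A) n \<subseteq> tuples (univ B) n" for n
        unfolding substruct_def tuples_def by blast
      then show "pres R \<Lambda> A B"
        using AC BC AB unfolding pres_def by blast
    qed
    show "\<exists>\<mu> :: ('k + 'r + nat \<Rightarrow> bool) rel. LS_axiom ?L ?K (pres R \<Lambda>) \<mu>"
      using LS by blast
    show "\<forall>(\<delta> :: 'i rel) A. limit_ord \<delta> \<and> cont_chain ?L ?K (pres R \<Lambda>) \<delta> A \<longrightarrow>
      union_struct ?L A (Field \<delta>) \<in> ?K \<and>
      (\<forall>j\<in>Field \<delta>. pres R \<Lambda> (A j) (union_struct ?L A (Field \<delta>))) \<and>
      (\<forall>B. (\<forall>i\<in>Field \<delta>. pres R \<Lambda> (A i) B) \<longrightarrow> pres R \<Lambda> (union_struct ?L A (Field \<delta>)) B)"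
    proof (intro allI impI, elim conjE)
      fix \<delta> :: "'i rel" and A :: "'i \<Rightarrow> ('r, 'a) mod_struct"
      assume \<delta>: "limit_ord \<delta>" and A: "cont_chain ?L ?K (pres R \<Lambda>) \<delta> A"
      have ne: "Field \<delta> \<noteq> {}" using \<delta> by (simp add: limit_ord_def)
      have K: "A i \<in> ?K" if "i \<in> Field \<delta>" for i using A that by (simp add: cont_chain_def)
      have total: "(i, j) \<in> \<delta> \<or> (j, i) \<in> \<delta>" if "i \<in> Field \<delta>" "j \<in> Field \<delta>" for i j
        using \<delta> that by (intro Well_orderD(4)) (auto simp: limit_ord_def)
      have chain: "pres R \<Lambda> (A i) (A j) \<or> pres R \<Lambda> (A j) (A i)"
        if "i \<in> Field \<delta>" "j \<in> Field \<delta>" for i j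
        using total[OF that] A unfolding cont_chain_def by blast
      note union = pres_union_chain[where A = A and S = S, OF R \<kappa> ne K chain[unfolded \<Lambda>_def], folded \<Lambda>_def]
      show "union_struct ?L A (Field \<delta>) \<in> ?K \<and>
        (\<forall>j\<in>Field \<delta>. pres R \<Lambda> (A j) (union_struct ?L A (Field \<delta>))) \<and>
        (\<forall>B. (\<forall>i\<in>Field \<delta>. pres R \<Lambda> (A i) B) \<longrightarrow> pres R \<Lambda> (union_struct ?L A (Field \<delta>)) B)"
        using union by blast
    qed
  qed
qed

theorem lemma4p25:
  fixes R :: "('r, 'x) ring_scheme" and \<kappa> :: "'k rel" and \<alpha> :: "'o rel"
  assumes "ring R" and "Cinfinite \<kappa>" and "Well_order \<alpha>"
  shows "AEC TYPE('i) TYPE('k + 'r + nat \<Rightarrow> bool) (mod_lang R)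
      (RMod R :: ('r, 'a) mod_struct set) (pp_le R \<kappa> \<alpha>) \<and>
    (LS_number (mod_lang R) (RMod R :: ('r, 'a) mod_struct set) (pp_le R \<kappa> \<alpha>)
        :: ('k + 'r + nat \<Rightarrow> bool) rel)
      \<le>o ctwo ^c card_pred (\<kappa> +c |carrier R| +c natLeq) \<and>
    AEC TYPE('i) TYPE('k + 'r + nat \<Rightarrow> bool) (mod_lang R)
      (RMod R :: ('r, 'a) mod_struct set) (pp_inf_le R \<kappa>) \<and>
    (LS_number (mod_lang R) (RMod R :: ('r, 'a) mod_struct set) (pp_inf_le R \<kappa>)
        :: ('k + 'r + nat \<Rightarrow> bool) rel)
      \<le>o ctwo ^c card_pred (\<kappa> +c |carrier R| +c natLeq)"
proof -
  have le: "pp_le R \<kappa> \<alpha> = pres R (\<lambda>\<epsilon>. \<Union>\<alpha>\<in>{\<alpha>}. pp_level R \<kappa> \<alpha> \<epsilon>)"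
    unfolding pp_le_def by simp
  have inf: "pp_inf_le R \<kappa> =
      pres R (\<lambda>\<epsilon>. \<Union>\<alpha>\<in>{\<alpha> :: ('k set \<times> nat) rel. Well_order \<alpha>}. pp_level R \<kappa> \<alpha> \<epsilon>)"
    unfolding pp_inf_le_def pp_inf_def[abs_def] ..
  show ?thesis
    unfolding le inf by (intro conjI AEC_pres_levels[OF assms(1,2)])
qed

end
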